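(* For every integer $g\ge 2$ let $x_g$ denote the unique root in $[0,1]$ of $f(x)=-x^{g-1}-x+1$. For every integer $g\ge 2$ and every $\varepsilon>0$ there exists an algorithm for the graphic matroid secretary problem which, on every weighted loopless multigraph $G$ of girth at least $g$, satisfies $\mathbb{E}[ALG]\ge \left(\frac{x_g}{e}-\varepsilon\right)OPT(G)$. In particular (since $x_g\to 1$ as $g\to\infty$), on graphs of girth at least $g$ one can achieve competitive ratio $e\,(1+o_g(1))$.
   Context: Graphic matroid secretary problem: the input is a finite undirected multigraph $G=(V,E)$ without loops, with $|E|=m$ and edge weights $w:E\to\mathbb{R}_{\ge 0}$; the algorithm knows $V$ and $m$ in advance. Edges arrive one at a time in a uniformly random order; upon arrival the algorithm learns the edge's endpoints and weight and must irrevocably accept or reject it, keeping the accepted set acyclic. The algorithm may be randomized. $ALG$ is the total accepted weight and $OPT(G)$ is the maximum weight of an acyclic edge set. The girth of a graph is the length of its shortest cycle (a pair of parallel edges is a cycle of length 2; a forest has infinite girth). An algorithm is $\alpha$-competitive on a family if $\alpha\,\mathbb{E}[ALG]\ge OPT(G)$ for all $G$ in the family. *)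

theory Defs
  imports "HOL-Probability.Probability" "HOL-Combinatorics.Multiset_Permutations"
begin

definition is_cycle :: "(nat \<Rightarrow> 'v \<times> 'v) \<Rightarrow> nat list \<Rightarrow> 'v list \<Rightarrow> bool" where
  "is_cycle ends es vs \<longleftrightarrow>
     length es = length vs \<and> length es \<ge> 2 \<and> distinct es \<and> distinct vs \<and>
     (\<forall>i<length es. ends (es!i) = (vs!i, vs!((i+1) mod length vs)) \<or>
                    ends (es!i) = (vs!((i+1) mod length vs), vs!i))"

definition acyclic_edges :: "(nat \<Rightarrow> 'v \<times> 'v) \<Rightarrow> nat set \<Rightarrow> bool" where
  "acyclic_edges ends F \<longleftrightarrow> \<not> (\<exists>es vs. is_cycle ends es vs \<and> set es \<subseteq> F)"

definition multigraph :: "'v set \<Rightarrow> nat \<Rightarrow> (nat \<Rightarrow> 'v \<times> 'v) \<Rightarrow> bool" where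
  "multigraph V m ends \<longleftrightarrow> finite V \<and>
     (\<forall>e<m. fst (ends e) \<in> V \<and> snd (ends e) \<in> V \<and> fst (ends e) \<noteq> snd (ends e))"

definition girth_ge :: "nat \<Rightarrow> (nat \<Rightarrow> 'v \<times> 'v) \<Rightarrow> nat \<Rightarrow> bool" where
  "girth_ge m ends g \<longleftrightarrow> (\<forall>es vs. is_cycle ends es vs \<and> set es \<subseteq> {0..<m} \<longrightarrow> length es \<ge> g)"

definition OPT :: "nat \<Rightarrow> (nat \<Rightarrow> 'v \<times> 'v) \<Rightarrow> (nat \<Rightarrow> real) \<Rightarrow> real" where
  "OPT m ends w = Max {sum w F | F. F \<subseteq> {0..<m} \<and> acyclic_edges ends F}"

text \<open>Observation of an arriving edge: its endpoints and its weight.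
  A deterministic online policy maps the history (past observations with the
  decisions taken) and the current observation to accept/reject.
  A randomized algorithm, knowing V and m, is a distribution over such policies.\<close>
type_synonym 'v obs = "'v \<times> 'v \<times> real"
type_synonym 'v policy = "('v obs \<times> bool) list \<Rightarrow> 'v obs \<Rightarrow> bool"
type_synonym 'v algorithm = "'v set \<Rightarrow> nat \<Rightarrow> 'v policy pmf"

text \<open>Running a policy on an arrival order; an edge is accepted only if the policy
  wants it and the accepted set stays acyclic (the policy can check this itself,
  since it knows the whole history, so this enforces feasibility w.l.o.g.).\<close>
fun run_aux :: "(nat \<Rightarrow> 'v \<times> 'v) \<Rightarrow> (nat \<Rightarrow> real) \<Rightarrow> 'v policy \<Rightarrow>
     ('v obs \<times> bool) list \<Rightarrow> nat set \<Rightarrow> nat list \<Rightarrow> nat set" where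
  "run_aux ends w P hist F [] = F"
| "run_aux ends w P hist F (e # es) =
     (let ob = (fst (ends e), snd (ends e), w e);
          acc = P hist ob \<and> acyclic_edges ends (insert e F)
      in run_aux ends w P (hist @ [(ob, acc)]) (if acc then insert e F else F) es)"

definition run :: "(nat \<Rightarrow> 'v \<times> 'v) \<Rightarrow> (nat \<Rightarrow> real) \<Rightarrow> 'v policy \<Rightarrow> nat list \<Rightarrow> nat set" where
  "run ends w P perm = run_aux ends w P [] {} perm"

definition expected_ALG :: "'v algorithm \<Rightarrow> 'v set \<Rightarrow> nat \<Rightarrow> (nat \<Rightarrow> 'v \<times> 'v) \<Rightarrow> (nat \<Rightarrow> real) \<Rightarrow> real" where
  "expected_ALG A V m ends w =
     measure_pmf.expectation
       (do { P \<leftarrow> A V m; perm \<leftarrow> pmf_of_set (permutations_of_set {0..<m});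
             return_pmf (run ends w P perm) })
       (\<lambda>F. sum w F)"

definition xg :: "nat \<Rightarrow> real" where
  "xg g = (THE x. 0 \<le> x \<and> x \<le> 1 \<and> - (x ^ (g - 1)) - x + 1 = 0)"

end

theory Submission
  imports Defs
begin

text \<open>
  Call a set of edges orientable if its edges can be given distinct endpoints as tails; forests are
  orientable. After a sampling phase, an arriving edge is marked if it belongs to the maximum-weight
  orientable subset of the edges seen so far and its tail there is not yet the tail of a marked
  edge. Each vertex is the tail of at most one edge, so its first mark behaves like a stop in the
  classical secretary problem, and the marked edges have expected weight at least \<open>OPT / e\<close>.

  Every vertex is the tail of at most one marked edge, so the cycles of marked edges are disjoint.
  A marked edge that closes no cycle of marked edges is accepted with probability \<open>x\<close>, by an
  independent coin; one that closes such a cycle is accepted whenever this is feasible, i.e. unless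
  the at least \<open>g - 1\<close> other edges of the cycle were all accepted. Each marked edge is thus accepted
  with probability at least \<open>min x (1 - x^(g - 1))\<close>, which is \<open>x\<close> for \<open>x = x_g\<close>.
\<close>

section \<open>The secretary constant\<close>

text \<open>The classical success probability when \<open>k\<close> of \<open>n\<close> candidates
  are sampled: the best one has \<open>t\<close> predecessors with probability \<open>1 / n\<close>,
  and then no earlier stop has occurred with probability \<open>k / t\<close>. The case
  \<open>t = k\<close> is separate because for \<open>k = 0\<close> the quotient would be
  \<open>0\<close> instead of \<open>1\<close>.\<close>

definition secretary_value :: "nat \<Rightarrow> nat \<Rightarrow> real" where
  "secretary_value k n = (\<Sum>t=k..<n. if t = k then 1 else real k / real t) / real n"

text \<open>By convexity of \<open>1 / x\<close>, its integral over a unit interval is at most the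
  trapezoid; the half weights at the two ends give the second summand. This correction later pays
  for rounding.\<close>

lemma sum_inverse_ge_ln:
  assumes "1 \<le> k" "k \<le> n"
  shows "ln (n / k) + (1 / k - 1 / n) / 2 \<le> (\<Sum>t=k..<n. 1 / real t)"
  using assms(2)
proof (induction n rule: dec_induct)
  case base
  then show ?case using assms by simp
next
  case (step n)
  have n: "real n > 0" using step assms by simp
  have 1: "ln (Suc n / k) = ln (n / k) + (ln (real n + 1) - ln (real n))"
    using n assms by (simp add: ln_div)
  have 2: "ln (real n + 1) - ln (real n) \<le> (1 / n + 1 / Suc n) / 2"
    using ln_inverse_approx_le[OF n, of 1] by (simp add: inverse_eq_divide add_ac)
  have "(\<Sum>t=k..<Suc n. 1 / real t) = (\<Sum>t=k..<n. 1 / real t) + 1 / n"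
    using step by simp
  moreover have "(l + d) + (a - c) / 2 \<le> s + b"
    if "d \<le> (b + c) / 2" "l + (a - b) / 2 \<le> s" for a b c d l s :: real
    using that by (simp add: field_simps)
  ultimately show ?case using 1 2 step.IH by presburger
qed

lemma secretary_value_small:
  "secretary_value 0 1 = 1" "secretary_value 1 2 = 1/2" "secretary_value 1 3 = 1/2"
  by (simp_all add: secretary_value_def numeral_eq_Suc)

text \<open>Rounding \<open>m / exp 1\<close> to the nearest integer costs only a quadratic error,
  which the trapezoid correction covers. So the bound is exact for every \<open>m\<close> and not
  only asymptotic.\<close>

lemma ex_secretary_value_ge:
  assumes "m \<ge> 1"
  shows "\<exists>k. secretary_value k m \<ge> 1 / exp 1"
proof -
  have e2: "exp (1::real) \<ge> 2" using exp_ge_add_one_self[of 1] by simp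
  then have half: "1 / exp 1 \<le> (1/2 :: real)" by (simp add: field_simps)
  have e3: "exp (1::real) \<le> 3" by (rule exp_le)
  consider "m = 1" | "m = 2" | "m = 3" | "m \<ge> 4" using assms by linarith
  then show ?thesis
  proof cases
    case 4
    define a where "a = real m / exp 1"
    define k where "k = nat (round a)"
    have "4 / 3 \<le> a" unfolding a_def using 4 e3 by (intro frac_le) auto
    have "\<bar>real_of_int (round a) - a\<bar> \<le> 1/2" by (rule of_int_round_abs_le)
    moreover from this have "0 \<le> round a" using \<open>4/3 \<le> a\<close> by linarith
    ultimately have ka: "\<bar>real k - a\<bar> \<le> 1/2" by (simp add: k_def)
    then have k1: "k \<ge> 1" using \<open>4/3 \<le> a\<close> by linarith
    have am: "a \<le> m / 2" unfolding a_def using e2 by (intro divide_left_mono) auto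
    have "real m \<ge> 4" using 4 by simp
    then have km: "real k + 3/2 \<le> m" using ka am by linarith
    then have "k \<le> m" by simp
    have m_eq: "real m = a * exp 1" by (simp add: a_def)
    have a0: "a > 0" using \<open>4/3 \<le> a\<close> by simp
    \<comment> \<open>The tangent of \<open>ln\<close> at \<open>1\<close> makes the loss against
      \<open>a\<close> quadratic in the rounding error \<open>k - a\<close>.\<close>
    have "ln (m / k) = 1 - ln (k / a)"
      using k1 a0 by (simp add: m_eq ln_div ln_mult)
    moreover have "ln (k / a) \<le> k / a - 1" using k1 a0 by (intro ln_le_minus_one) auto
    ultimately have "ln (m / k) \<ge> 2 - k / a" by simp
    then have "k * ln (m / k) \<ge> k * (2 - k / a)" by (intro mult_left_mono) auto
    also have "k * (2 - k / a) = a - (k - a)\<^sup>2 / a"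
      using a0 by (simp add: field_simps power2_eq_square)
    finally have 1: "k * ln (m / k) \<ge> a - (k - a)\<^sup>2 / a" .
    have "(real k - a)\<^sup>2 = \<bar>real k - a\<bar>\<^sup>2" by simp
    also have "\<dots> \<le> (1/2)\<^sup>2" using ka by (intro power_mono) auto
    finally have "(real k - a)\<^sup>2 / a \<le> (1/4) / a"
      using a0 by (intro divide_right_mono) (auto simp: power2_eq_square)
    also have "\<dots> = exp 1 / 4 / m" by (simp add: a_def)
    \<comment> \<open>From \<open>k + 3/2 \<le> m\<close> the right side is at least
      \<open>3 / (4 * m)\<close>, and \<open>exp 1 \<le> 3\<close>.\<close>
    also have "\<dots> \<le> (1 - k / m) / 2"
      using km e3 4 by (simp add: field_simps)
    finally have "a \<le> k * ln (m / k) + (1 - k / m) / 2" using 1 by linarith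
    also have "\<dots> = k * (ln (m / k) + (1 / k - 1 / m) / 2)"
      using k1 by (simp add: field_simps)
    also have "\<dots> \<le> k * (\<Sum>t=k..<m. 1 / real t)"
      using sum_inverse_ge_ln[OF k1 \<open>k \<le> m\<close>] by (intro mult_left_mono) auto
    also have "\<dots> = (\<Sum>t=k..<m. if t = k then 1 else real k / real t)"
      using k1 by (auto simp: sum_distrib_left intro!: sum.cong)
    finally have "a / m \<le> secretary_value k m"
      unfolding secretary_value_def by (rule divide_right_mono) simp
    moreover have "a / m = 1 / exp 1" using 4 by (simp add: a_def)
    ultimately show ?thesis by auto
  next
    case 1
    then show ?thesis using secretary_value_small(1) e2 by (intro exI[of _ 0]) simp
  next
    case 2
    then show ?thesis using secretary_value_small(2) half by metis
  next
    case 3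
    then show ?thesis using secretary_value_small(3) half by metis
  qed
qed

section \<open>The root $x_g$\<close>

text \<open>The function \<open>x ^ (g - 1) + x\<close> increases strictly on the nonnegative reals,
  so the root found by the intermediate value theorem is the only one and \<open>THE\<close> is well
  defined.\<close>

lemma xg_root:
  assumes "g \<ge> 2"
  shows "0 \<le> xg g" "xg g \<le> 1" "xg g ^ (g - 1) = 1 - xg g"
proof -
  define f :: "real \<Rightarrow> real" where "f x = x ^ (g - 1) + x" for x
  have "\<exists>x\<ge>0. x \<le> 1 \<and> f x = 1"
    by (rule IVT'[of f]) (use assms in \<open>auto simp: f_def power_0_left intro!: continuous_intros\<close>)
  moreover have "x = y" if "0 \<le> x" "0 \<le> y" "f x = f y" for x y
  proof (rule ccontr)
    assume "x \<noteq> y"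
    moreover have "f a < f b" if "0 \<le> a" "a < b" for a b
      using that power_mono[of a b "g - 1"] by (simp add: f_def add_le_less_mono)
    then have "f x \<noteq> f y" if "x \<noteq> y"
      using \<open>0 \<le> x\<close> \<open>0 \<le> y\<close> that by (cases x y rule: linorder_cases) force+
    ultimately show False using \<open>f x = f y\<close> by blast
  qed
  ultimately have "\<exists>!x. 0 \<le> x \<and> x \<le> 1 \<and> f x = 1"
    by (intro ex_ex1I) (blast, auto)
  moreover have "- (x ^ (g - 1)) - x + 1 = 0 \<longleftrightarrow> f x = 1" for x by (auto simp: f_def)
  ultimately have "0 \<le> xg g \<and> xg g \<le> 1 \<and> f (xg g) = 1"
    unfolding xg_def by (simp only:) (rule theI')
  then show "0 \<le> xg g" "xg g \<le> 1" "xg g ^ (g - 1) = 1 - xg g" by (auto simp: f_def)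
qed

text \<open>If \<open>xg g \<le> b < 1\<close> with \<open>b \<ge> 0\<close>, then
  \<open>1 - b \<le> xg g ^ (g - 1) \<le> b ^ (g - 1)\<close>, which fails for large
  \<open>g\<close>.\<close>

lemma xg_tendsto_1: "xg \<longlonglongrightarrow> 1"
proof (rule order_tendstoI)
  fix a :: real assume "a < 1"
  define b where "b = max a 0"
  have b: "0 \<le> b" "b < 1" "a \<le> b" using \<open>a < 1\<close> by (auto simp: b_def)
  have "(\<lambda>n. b ^ n) \<longlonglongrightarrow> 0" using b by (intro LIMSEQ_power_zero) auto
  then have "eventually (\<lambda>n. b ^ n < 1 - b) sequentially" using b
    by (intro order_tendstoD(2)[of _ 0]) auto
  then obtain N where N: "\<And>n. n \<ge> N \<Longrightarrow> b ^ n < 1 - b" by (auto simp: eventually_sequentially)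
  have "b < xg g" if "g \<ge> N + 2" for g
  proof (rule ccontr)
    assume "\<not> b < xg g"
    then have "xg g ^ (g - 1) \<le> b ^ (g - 1)" using xg_root[of g] that by (intro power_mono) auto
    also have "\<dots> < 1 - b" using that by (intro N) auto
    finally show False using xg_root[of g] that \<open>\<not> b < xg g\<close> by simp
  qed
  then show "eventually (\<lambda>g. a < xg g) sequentially"
    using b(3) unfolding eventually_sequentially by (meson le_less_trans)
next
  fix a :: real assume "1 < a"
  then show "eventually (\<lambda>g. xg g < a) sequentially"
    unfolding eventually_sequentially using xg_root(2) by (meson le_less_trans)
qed

section \<open>Edge orientations with out-degree at most one\<close>

text \<open>\<open>h\<close> sends each oriented edge to its tail; injectivity is out-degree at most
  one. In a finite graph the possible domains are the independent sets of the bicircular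
  matroid.\<close>

definition orientation :: "(nat \<Rightarrow> 'v \<times> 'v) \<Rightarrow> (nat \<rightharpoonup> 'v) \<Rightarrow> bool" where
  "orientation ends h \<longleftrightarrow> inj_on h (dom h) \<and>
     (\<forall>e v. h e = Some v \<longrightarrow> v = fst (ends e) \<or> v = snd (ends e))"

lemma orientation_empty: "orientation ends Map.empty"
  by (simp add: orientation_def)

lemma orientation_restrict: "orientation ends h \<Longrightarrow> orientation ends (h |` A)"
  by (auto simp: orientation_def inj_on_def restrict_map_def dom_def split: if_splits)

lemma orientation_upd:
  assumes "orientation ends h" "v = fst (ends e) \<or> v = snd (ends e)" "v \<notin> ran h"
  shows "orientation ends (h(e \<mapsto> v))"
  using assms unfolding orientation_def inj_on_def
  by (auto simp: dom_def ran_def split: if_splits)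

lemma is_cycle_ends:
  assumes "is_cycle ends es vs" "i < length es"
  shows "ends (es!i) = (vs!i, vs!((i+1) mod length es)) \<or>
         ends (es!i) = (vs!((i+1) mod length es), vs!i)"
  using assms by (simp add: is_cycle_def)

lemma is_cycle_endpoints:
  assumes "is_cycle ends es vs" "e \<in> set es"
  shows "fst (ends e) \<in> set vs" "snd (ends e) \<in> set vs"
proof -
  obtain i where i: "i < length es" "es!i = e"
    using assms(2) by (auto simp: in_set_conv_nth)
  have l: "length vs = length es" using assms by (simp add: is_cycle_def)
  have "(i+1) mod length es < length es"
    using i by (intro mod_less_divisor) auto
  then have "vs!i \<in> set vs" "vs!((i+1) mod length es) \<in> set vs"
    using i l by simp_all
  then show "fst (ends e) \<in> set vs" "snd (ends e) \<in> set vs"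
    using is_cycle_ends[OF assms(1) i(1)] i(2) by auto
qed

text \<open>The tails lie among the vertices of the cycle, and there are as many of them as edges,
  hence as vertices.\<close>

lemma cycle_tails:
  assumes "orientation ends h" "is_cycle ends es vs" "set es \<subseteq> dom h"
  shows "(\<lambda>e. the (h e)) ` set es = set vs"
proof (rule card_subset_eq)
  show "(\<lambda>e. the (h e)) ` set es \<subseteq> set vs"
  proof clarify
    fix e assume e: "e \<in> set es"
    then obtain v where "h e = Some v" using assms(3) by auto
    then show "the (h e) \<in> set vs"
      using assms(1) is_cycle_endpoints[OF assms(2) e] by (auto simp: orientation_def)
  qed
  have "inj_on (\<lambda>e. the (h e)) (set es)"
    using assms(1,3) unfolding orientation_def inj_on_def
    by (metis domIff option.expand subsetD)
  then have "card ((\<lambda>e. the (h e)) ` set es) = length es"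
    using assms(2) by (simp add: card_image is_cycle_def distinct_card)
  also have "\<dots> = card (set vs)"
    using assms(2) by (simp add: is_cycle_def distinct_card)
  finally show "card ((\<lambda>e. the (h e)) ` set es) = card (set vs)" .
qed simp

lemma cyclic_closed_eq:
  assumes "I \<subseteq> {..<n}" "i \<in> I" "\<And>i. i \<in> I \<Longrightarrow> (i+1) mod n \<in> I"
  shows "I = {..<n::nat}"
proof -
  have step: "(i+k) mod n \<in> I" for k
  proof (induction k)
    case 0
    then show ?case using assms(1,2) by auto
  next
    case (Suc k)
    from assms(3)[OF this] show ?case by (simp add: mod_Suc_eq)
  qed
  have "j \<in> I" if "j < n" for j
  proof -
    have "i < n" using assms by auto
    then have "(i + (n - i + j)) mod n = j" using that by simp
    then show ?thesis using step by metis
  qed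
  then show ?thesis using assms(1) by auto
qed

text \<open>The common edges are the edges leaving the common vertices, so the set of common vertices
  is closed under moving along the first cycle.\<close>
lemma oriented_cycle_subset:
  assumes h: "orientation ends h"
    and c: "is_cycle ends es vs" "set es \<subseteq> dom h"
    and c': "is_cycle ends es' vs'" "set es' \<subseteq> dom h"
    and e: "e \<in> set es" "e \<in> set es'"
  shows "set es \<subseteq> set es'"
proof -
  let ?n = "length es" and ?t = "\<lambda>e. the (h e)"
  have l: "length vs = ?n" and d: "distinct es" "distinct vs"
    using c(1) by (auto simp: is_cycle_def)
  define I where "I = {i. i < ?n \<and> vs!i \<in> set vs'}"
  define J where "J = {i. i < ?n \<and> es!i \<in> set es'}"
  have fin: "finite I" by (simp add: I_def)
  have JI: "i \<in> I \<and> (i+1) mod ?n \<in> I" if "i \<in> J" for i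
  proof -
    have "i < ?n" "es!i \<in> set es'" using that by (auto simp: J_def)
    moreover have "(i+1) mod ?n < ?n" using calculation by (intro mod_less_divisor) auto
    ultimately show ?thesis
      using is_cycle_ends[OF c(1), of i] is_cycle_endpoints[OF c'(1), of "es!i"]
      by (auto simp: I_def)
  qed
  have inj: "inj_on ?t (set es \<union> set es')"
    using h c(2) c'(2) unfolding orientation_def inj_on_def
    by (metis UnE domIff option.expand subsetD)
  have "(!) es ` J = set es \<inter> set es'"
  proof
    show "set es \<inter> set es' \<subseteq> (!) es ` J"
    proof
      fix x assume x: "x \<in> set es \<inter> set es'"
      then obtain i where "i < ?n" "es!i = x" by (auto simp: in_set_conv_nth)
      then show "x \<in> (!) es ` J" using x by (intro image_eqI[of _ _ i]) (auto simp: J_def)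
    qed
  qed (auto simp: J_def)
  moreover have "inj_on ((!) es) J"
    using d(1) by (auto simp: J_def inj_on_def nth_eq_iff_index_eq)
  ultimately have "card J = card (set es \<inter> set es')"
    by (metis card_image)
  also have "\<dots> = card (?t ` (set es \<inter> set es'))"
    by (rule card_image[symmetric], rule inj_on_subset[OF inj]) auto
  \<comment> \<open>Tails are injective on both cycles together, and the tails of each cycle are all
    of its vertices, so common edges correspond one to one to common vertices.\<close>
  also have "?t ` (set es \<inter> set es') = set vs \<inter> set vs'"
    using inj_on_image_Int[OF inj] cycle_tails[OF h c] cycle_tails[OF h c'] by simp
  also have "(!) vs ` I = set vs \<inter> set vs'"
  proof
    show "set vs \<inter> set vs' \<subseteq> (!) vs ` I"
    proof
      fix x assume x: "x \<in> set vs \<inter> set vs'"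
      then obtain i where "i < ?n" "vs!i = x" using l by (auto simp: in_set_conv_nth)
      then show "x \<in> (!) vs ` I" using x by (intro image_eqI[of _ _ i]) (auto simp: I_def)
    qed
  qed (use l in \<open>auto simp: I_def\<close>)
  then have "card (set vs \<inter> set vs') = card ((!) vs ` I)" by simp
  also have "\<dots> = card I"
    using d(2) l by (intro card_image) (auto simp: I_def inj_on_def nth_eq_iff_index_eq)
  finally have "J = I"
    using JI fin by (intro card_subset_eq) auto
  obtain i where "i \<in> J"
    using e by (auto simp: J_def in_set_conv_nth)
  have "J = {..<?n}"
    by (rule cyclic_closed_eq[OF _ \<open>i \<in> J\<close>]) (use \<open>J = I\<close> JI in \<open>auto simp: J_def\<close>)
  then have "es ! i \<in> set es'" if "i < ?n" for i
    using that by (auto simp: J_def)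
  then show ?thesis by (auto simp: in_set_conv_nth)
qed

lemma oriented_cycle_unique:
  assumes "orientation ends h"
    and "is_cycle ends es vs" "set es \<subseteq> dom h" "is_cycle ends es' vs'" "set es' \<subseteq> dom h"
    and "e \<in> set es" "e \<in> set es'"
  shows "set es = set es'"
  using oriented_cycle_subset[OF assms] oriented_cycle_subset[OF assms(1,4,5,2,3,7,6)] by auto

section \<open>Orientability of forests\<close>

text \<open>The first repetition of a vertex bounds a stretch of the walk with distinct vertices.
  Without loops it has at least two edges, and without backtracking its edges are distinct.\<close>

lemma nonbacktracking_walk_cycle:
  fixes v :: "nat \<Rightarrow> 'v" and e :: "nat \<Rightarrow> nat"
  assumes "finite (range v)" "range e \<subseteq> F"
    and adj: "\<And>n. ends (e n) = (v n, v (Suc n)) \<or> ends (e n) = (v (Suc n), v n)"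
    and nloop: "\<And>n. v n \<noteq> v (Suc n)" and nback: "\<And>n. e n \<noteq> e (Suc n)"
  shows "\<not> acyclic_edges ends F"
proof -
  have "\<not> inj v" using assms(1) finite_imageD infinite_UNIV_nat by blast
  then have ex: "\<exists>j. \<exists>i<j. v i = v j"
    unfolding inj_def by (metis nat_neq_iff)
  define j where "j = (LEAST j. \<exists>i<j. v i = v j)"
  obtain i where ij: "i < j" "v i = v j"
    using LeastI_ex[OF ex] unfolding j_def by blast
  have inj: "v a \<noteq> v b" if "a < b" "b < j" for a b
    using not_less_Least[of b "\<lambda>j. \<exists>i<j. v i = v j"] that by (auto simp: j_def)
  define n where "n = j - i"
  have "n \<noteq> 1"
  proof
    assume "n = 1"
    then have "j = Suc i" by (simp add: n_def)
    then show False using nloop[of i] ij by simp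
  qed
  then have n2: "n \<ge> 2" and j: "j = i + n" using ij by (auto simp: n_def)
  have inj_iff: "v a = v b \<longleftrightarrow> a = b" if "a < j" "b < j" for a b
    using inj[of a b] inj[of b a] that by (cases a b rule: linorder_cases) auto
  \<comment> \<open>Equal edges with different first vertices are traversed in opposite directions,
    so they would be consecutive.\<close>
  have neq: "e a \<noteq> e b" if "i \<le> a" "a < b" "b < j" for a b
  proof
    assume "e a = e b"
    with adj[of a] adj[of b] inj_iff[of a b] that
    have "v (Suc a) = v b" by auto
    then have "b = Suc a" using inj_iff[of "Suc a" b] that by auto
    with \<open>e a = e b\<close> nback[of a] show False by simp
  qed
  have e_inj: "a = b" if "i \<le> a" "i \<le> b" "a < j" "b < j" "e a = e b" for a b
    using neq[of a b] neq[of b a] that by (cases a b rule: linorder_cases) auto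
  have "is_cycle ends (map e [i..<j]) (map v [i..<j])"
    unfolding is_cycle_def
  proof (intro conjI allI impI)
    show "distinct (map e [i..<j])" "distinct (map v [i..<j])"
      using e_inj inj_iff by (auto simp: distinct_map inj_on_def)
    fix k assume "k < length (map e [i..<j])"
    then have k: "k < n" by (simp add: n_def)
    \<comment> \<open>The last step of the stretch wraps around, where \<open>v i = v j\<close>
      closes the cycle.\<close>
    then have "v (i + (k+1) mod n) = v (Suc (i + k))"
      using ij j by (cases "Suc k = n") auto
    moreover have "(k+1) mod n < n" using n2 by simp
    ultimately show "ends (map e [i..<j] ! k) = (map v [i..<j] ! k, map v [i..<j] ! ((k+1) mod length (map v [i..<j]))) \<or>
          ends (map e [i..<j] ! k) = (map v [i..<j] ! ((k+1) mod length (map v [i..<j])), map v [i..<j] ! k)"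
      using adj[of "i+k"] k by (simp add: j nth_append)
  qed (use n2 n_def in auto)
  moreover have "set (map e [i..<j]) \<subseteq> F" using assms(2) by auto
  ultimately show ?thesis unfolding acyclic_edges_def by blast
qed

text \<open>If each endpoint of each edge met a further edge, a walk could always leave a vertex by
  another edge than it entered, and would go on forever without backtracking.\<close>

lemma acyclic_leaf:
  assumes F: "finite F" "F \<noteq> {}" and nl: "\<And>e. e \<in> F \<Longrightarrow> fst (ends e) \<noteq> snd (ends e)"
    and "acyclic_edges ends F"
  obtains e v where "e \<in> F" "v = fst (ends e) \<or> v = snd (ends e)"
    "\<And>e'. e' \<in> F \<Longrightarrow> e' \<noteq> e \<Longrightarrow> v \<noteq> fst (ends e') \<and> v \<noteq> snd (ends e')"
proof (rule ccontr)
  note witness = that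
  assume "\<not> thesis"
  then have other: "\<exists>e'\<in>F. e' \<noteq> e \<and> (v = fst (ends e') \<or> v = snd (ends e'))"
    if "e \<in> F" "v = fst (ends e) \<or> v = snd (ends e)" for e v
    using witness[of e v] that by blast
  \<comment> \<open>The states are directed edges: \<open>(e, u, v)\<close> traverses
    \<open>e\<close> from \<open>u\<close> to \<open>v\<close>.\<close>
  define P where "P = (\<lambda>(e :: nat, u, v :: 'a). e \<in> F \<and> (ends e = (u, v) \<or> ends e = (v, u)))"
  define Q where "Q = (\<lambda>(e :: nat, u :: 'a, v :: 'a) (e', u', v' :: 'a). e' \<noteq> e \<and> u' = v)"
  have "\<exists>f. \<forall>n. P (f n) \<and> Q (f n) (f (Suc n))"
  proof (rule dependent_nat_choice)
    obtain e where "e \<in> F" using F by auto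
    then have "P (e, ends e)" by (auto simp: P_def split: prod.splits)
    then show "\<exists>x. P x" ..
    fix x and n :: nat assume "P x"
    obtain e u v where x: "x = (e, u, v)" by (cases x)
    then have "e \<in> F" "v = fst (ends e) \<or> v = snd (ends e)"
      using \<open>P x\<close> by (auto simp: P_def)
    from other[OF this] obtain e' where e': "e' \<in> F" "e' \<noteq> e" "v = fst (ends e') \<or> v = snd (ends e')"
      by auto
    then obtain v' where "ends e' = (v, v') \<or> ends e' = (v', v)" by (metis prod.collapse)
    then show "\<exists>y. P y \<and> Q x y"
      using e' x by (intro exI[of _ "(e', v, v')"]) (auto simp: P_def Q_def)
  qed
  then obtain f where f: "\<And>n. P (f n)" "\<And>n. Q (f n) (f (Suc n))" by blast
  define e where "e n = fst (f n)" for n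
  define v where "v n = fst (snd (f n))" for n
  have v': "snd (snd (f n)) = v (Suc n)" "e (Suc n) \<noteq> e n" for n
    using f(2)[of n] by (auto simp: Q_def v_def e_def split: prod.splits)
  have P: "e n \<in> F" "ends (e n) = (v n, v (Suc n)) \<or> ends (e n) = (v (Suc n), v n)" for n
    using f(1)[of n] v'(1)[of n] by (auto simp: P_def v_def e_def split: prod.splits)
  have "range v \<subseteq> (\<lambda>e. fst (ends e)) ` F \<union> (\<lambda>e. snd (ends e)) ` F"
  proof clarsimp
    fix n assume "v n \<notin> (\<lambda>e. snd (ends e)) ` F"
    then show "v n \<in> (\<lambda>e. fst (ends e)) ` F" using P[of n] by force
  qed
  then have "finite (range v)" using F(1) by (meson finite_UnI finite_imageI finite_subset)
  moreover have "v n \<noteq> v (Suc n)" for n using P[of n] nl by force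
  ultimately have "\<not> acyclic_edges ends F"
    using P v'(2)[symmetric] by (intro nonbacktracking_walk_cycle[of v e]) auto
  with assms show False by simp
qed

lemma acyclic_edges_subset: "acyclic_edges ends F \<Longrightarrow> F' \<subseteq> F \<Longrightarrow> acyclic_edges ends F'"
  by (auto simp: acyclic_edges_def)

text \<open>Peel off a leaf: no other edge meets it, so it is free as the tail of its only
  edge.\<close>

lemma acyclic_orientation:
  assumes "finite F" "\<And>e. e \<in> F \<Longrightarrow> fst (ends e) \<noteq> snd (ends e)" "acyclic_edges ends F"
  shows "\<exists>h. orientation ends h \<and> dom h = F"
  using assms
proof (induction F rule: finite_psubset_induct)
  case (psubset F)
  show ?case
  proof (cases "F = {}")
    case True
    then show ?thesis using orientation_empty by (intro exI[of _ Map.empty]) auto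
  next
    case False
    obtain e v where ev: "e \<in> F" "v = fst (ends e) \<or> v = snd (ends e)"
      "\<And>e'. e' \<in> F \<Longrightarrow> e' \<noteq> e \<Longrightarrow> v \<noteq> fst (ends e') \<and> v \<noteq> snd (ends e')"
      using acyclic_leaf[OF psubset.hyps False psubset.prems] by metis
    have "\<exists>h. orientation ends h \<and> dom h = F - {e}"
      using psubset.IH[of "F - {e}"] ev(1) psubset.prems acyclic_edges_subset[of ends F "F - {e}"]
      by auto
    then obtain h where h: "orientation ends h" "dom h = F - {e}" by blast
    have "v \<notin> ran h"
    proof
      assume "v \<in> ran h"
      then obtain e' where "h e' = Some v" by (auto simp: ran_def)
      moreover from this have "e' \<in> F" "e' \<noteq> e" using h(2) by auto
      ultimately show False using ev(3)[of e'] h(1) by (auto simp: orientation_def)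
    qed
    then have "orientation ends (h(e \<mapsto> v))"
      by (rule orientation_upd[OF h(1) ev(2)])
    moreover have "dom (h(e \<mapsto> v)) = F" using h(2) ev(1) by auto
    ultimately show ?thesis by blast
  qed
qed

section \<open>Maximum-weight orientations\<close>

text \<open>\<open>D\<close> maps edge names to observations. All that the policy computes is
  phrased in terms of \<open>D\<close>, because it knows edges only through observations.\<close>

abbreviation obs_ends :: "(nat \<Rightarrow> 'v obs) \<Rightarrow> nat \<Rightarrow> 'v \<times> 'v" where
  "obs_ends D \<equiv> \<lambda>e. (fst (D e), fst (snd (D e)))"

abbreviation obs_weight :: "(nat \<Rightarrow> 'v obs) \<Rightarrow> nat \<Rightarrow> real" where
  "obs_weight D \<equiv> \<lambda>e. snd (snd (D e))"

text \<open>The choice depends on the set \<open>S\<close> and not on its order of arrival: given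
  the set seen so far, the orientation is fixed while the last arrival is still uniform.\<close>

definition best_orientation :: "(nat \<Rightarrow> 'v obs) \<Rightarrow> nat set \<Rightarrow> (nat \<rightharpoonup> 'v)" where
  "best_orientation D S = (SOME h. dom h \<subseteq> S \<and> orientation (obs_ends D) h \<and>
     (\<forall>h'. dom h' \<subseteq> S \<longrightarrow> orientation (obs_ends D) h' \<longrightarrow>
        sum (obs_weight D) (dom h') \<le> sum (obs_weight D) (dom h)))"

abbreviation best_weight :: "(nat \<Rightarrow> 'v obs) \<Rightarrow> nat set \<Rightarrow> real" where
  "best_weight D S \<equiv> sum (obs_weight D) (dom (best_orientation D S))"

lemma best_orientation:
  assumes "finite S"
  shows "orientation (obs_ends D) (best_orientation D S)" "dom (best_orientation D S) \<subseteq> S"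
    "\<And>h. orientation (obs_ends D) h \<Longrightarrow> dom h \<subseteq> S \<Longrightarrow>
       sum (obs_weight D) (dom h) \<le> best_weight D S"
proof -
  let ?H = "{h. orientation (obs_ends D) h \<and> dom h \<subseteq> S}"
  let ?W = "(\<lambda>h. sum (obs_weight D) (dom h)) ` ?H"
  have "?W \<subseteq> sum (obs_weight D) ` Pow S" by auto
  then have fin: "finite ?W" using assms by (meson finite_Pow_iff finite_imageI finite_subset)
  have "Map.empty \<in> ?H" using orientation_empty by auto
  then have "?W \<noteq> {}" by blast
  then have "Max ?W \<in> ?W" using fin by (rule Max_in[rotated])
  then obtain h where "h \<in> ?H" "sum (obs_weight D) (dom h) = Max ?W" by auto
  then have "dom h \<subseteq> S \<and> orientation (obs_ends D) h \<and>
     (\<forall>h'. dom h' \<subseteq> S \<longrightarrow> orientation (obs_ends D) h' \<longrightarrow>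
        sum (obs_weight D) (dom h') \<le> sum (obs_weight D) (dom h))"
    using Max_ge[OF fin] by auto
  note someI[of "\<lambda>h. dom h \<subseteq> S \<and> orientation (obs_ends D) h \<and>
     (\<forall>h'. dom h' \<subseteq> S \<longrightarrow> orientation (obs_ends D) h' \<longrightarrow>
        sum (obs_weight D) (dom h') \<le> sum (obs_weight D) (dom h))", OF this]
  then show "orientation (obs_ends D) (best_orientation D S)" "dom (best_orientation D S) \<subseteq> S"
    "\<And>h. orientation (obs_ends D) h \<Longrightarrow> dom h \<subseteq> S \<Longrightarrow>
       sum (obs_weight D) (dom h) \<le> best_weight D S"
    unfolding best_orientation_def[symmetric] by auto
qed

lemma orientation_cong:
  "(\<And>e. e \<in> dom h \<Longrightarrow> ends e = ends' e) \<Longrightarrow> orientation ends h \<longleftrightarrow> orientation ends' h"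
  unfolding orientation_def by (metis domI)

text \<open>Locality: unseen edges have no influence, so a policy that knows \<open>D\<close> only
  on the arrivals so far can compute the orientation.\<close>

lemma best_orientation_cong:
  assumes "\<And>e. e \<in> S \<Longrightarrow> D e = D' e"
  shows "best_orientation D S = best_orientation D' S"
proof -
  have o: "orientation (obs_ends D) h \<longleftrightarrow> orientation (obs_ends D') h" if "dom h \<subseteq> S" for h
    using that assms by (intro orientation_cong) auto
  have w: "sum (obs_weight D) (dom h) = sum (obs_weight D') (dom h)" if "dom h \<subseteq> S" for h
    using that assms by (intro sum.cong) auto
  show ?thesis
    unfolding best_orientation_def
    by (simp add: o w cong: conj_cong)
qed

text \<open>The list \<open>\<rho>\<close> holds the arrivals so far, latest first.\<close>
fun marks :: "nat \<Rightarrow> (nat \<Rightarrow> 'v obs) \<Rightarrow> nat list \<Rightarrow> (nat \<rightharpoonup> 'v)" where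
  "marks k D [] = Map.empty"
| "marks k D (e # \<rho>) =
     (case best_orientation D (set (e # \<rho>)) e of
        None \<Rightarrow> marks k D \<rho>
      | Some v \<Rightarrow> if length \<rho> < k \<or> v \<in> ran (marks k D \<rho>) then marks k D \<rho>
                  else (marks k D \<rho>)(e \<mapsto> v))"

lemma marks_cong:
  "(\<And>e. e \<in> set \<rho> \<Longrightarrow> D e = D' e) \<Longrightarrow> marks k D \<rho> = marks k D' \<rho>"
proof (induction \<rho>)
  case (Cons e \<rho>)
  then have "best_orientation D (set (e # \<rho>)) = best_orientation D' (set (e # \<rho>))"
    by (intro best_orientation_cong) auto
  then show ?case using Cons by (simp split: option.split)
qed simp

lemma dom_marks_subset: "dom (marks k D \<rho>) \<subseteq> set \<rho>"
  by (induction \<rho>) (auto split: option.splits if_splits)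

lemma orientation_marks: "orientation (obs_ends D) (marks k D \<rho>)"
proof (induction \<rho>)
  case Nil
  then show ?case by (simp add: orientation_empty)
next
  case (Cons e \<rho>)
  have "v = fst (obs_ends D e) \<or> v = snd (obs_ends D e)"
    if "best_orientation D (set (e # \<rho>)) e = Some v" for v
    using best_orientation(1)[of "set (e # \<rho>)" D] that unfolding orientation_def by blast
  then show ?case
    using Cons.IH orientation_upd[of "obs_ends D" "marks k D \<rho>"]
    by (simp split: option.split)
qed

lemma marks_Cons_other: "e' \<noteq> e \<Longrightarrow> marks k D (e # \<rho>) e' = marks k D \<rho> e'"
  by (auto split: option.split)

lemma marks_append_other:
  "e \<notin> set \<rho>' \<Longrightarrow> marks k D (\<rho>' @ \<rho>) e = marks k D \<rho> e"
  by (induction \<rho>') (auto simp: marks_Cons_other simp del: marks.simps(2))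

lemma dom_marks_append:
  assumes "distinct (\<rho>' @ \<rho>)"
  shows "dom (marks k D \<rho>) \<subseteq> dom (marks k D (\<rho>' @ \<rho>))"
proof
  fix e assume e: "e \<in> dom (marks k D \<rho>)"
  then have "e \<in> set \<rho>" using dom_marks_subset by fastforce
  with assms have "e \<notin> set \<rho>'" by auto
  from marks_append_other[OF this, of k D \<rho>] e show "e \<in> dom (marks k D (\<rho>' @ \<rho>))" by auto
qed

section \<open>The weight of the marked edges\<close>

text \<open>The expectation over a uniformly random order of a finite \<open>S\<close>, as a plain
  sum that suits induction on \<open>S\<close>.\<close>

definition perm_mean :: "nat set \<Rightarrow> (nat list \<Rightarrow> real) \<Rightarrow> real" where
  "perm_mean S f = (\<Sum>\<rho>\<in>permutations_of_set S. f \<rho>) / fact (card S)"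

text \<open>Conditions on the head of the list, the latest arrival: it is uniform in
  \<open>S\<close>, and the others remain in uniform order.\<close>

lemma perm_mean_rec:
  assumes "finite S" "S \<noteq> {}"
  shows "perm_mean S f = (\<Sum>e\<in>S. perm_mean (S - {e}) (\<lambda>\<rho>. f (e # \<rho>))) / card S"
proof -
  have "(\<Sum>\<rho>\<in>permutations_of_set S. f \<rho>) =
      (\<Sum>e\<in>S. \<Sum>\<rho>\<in>(#) e ` permutations_of_set (S - {e}). f \<rho>)"
    using assms by (subst permutations_of_set_nonempty, simp, subst sum.UNION_disjoint) auto
  also have "\<dots> = (\<Sum>e\<in>S. \<Sum>\<rho>\<in>permutations_of_set (S - {e}). f (e # \<rho>))"
    by (rule sum.cong[OF refl]) (subst sum.reindex, simp_all)
  finally have "perm_mean S f =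
      (\<Sum>e\<in>S. \<Sum>\<rho>\<in>permutations_of_set (S - {e}). f (e # \<rho>)) / fact (card S)"
    by (simp add: perm_mean_def)
  also have "\<dots> = (\<Sum>e\<in>S. perm_mean (S - {e}) (\<lambda>\<rho>. f (e # \<rho>))) / card S"
    using assms fact_reduce[of "card S", where 'a = real]
    by (simp add: perm_mean_def sum_divide_distrib card_gt_0_iff card_Diff_singleton mult.commute)
  finally show ?thesis .
qed

lemma perm_mean_cong:
  "(\<And>\<rho>. \<rho> \<in> permutations_of_set S \<Longrightarrow> f \<rho> = g \<rho>) \<Longrightarrow> perm_mean S f = perm_mean S g"
  by (simp add: perm_mean_def)

lemma perm_mean_mono:
  "(\<And>\<rho>. \<rho> \<in> permutations_of_set S \<Longrightarrow> f \<rho> \<le> g \<rho>) \<Longrightarrow> perm_mean S f \<le> perm_mean S g"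
  by (simp add: perm_mean_def sum_mono divide_right_mono)

lemma perm_mean_add: "perm_mean S (\<lambda>\<rho>. f \<rho> + g \<rho>) = perm_mean S f + perm_mean S g"
  by (simp add: perm_mean_def sum.distrib add_divide_distrib)

lemma perm_mean_cmult: "perm_mean S (\<lambda>\<rho>. c * f \<rho>) = c * perm_mean S f"
  by (simp add: perm_mean_def sum_distrib_left)

lemma perm_mean_const: "finite S \<Longrightarrow> perm_mean S (\<lambda>_. c) = c"
  by (simp add: perm_mean_def)

lemma perm_mean_rev: "perm_mean S (\<lambda>\<rho>. f (rev \<rho>)) = perm_mean S f"
proof -
  have "(\<Sum>\<rho>\<in>permutations_of_set S. f (rev \<rho>)) = (\<Sum>\<rho>\<in>rev ` permutations_of_set S. f \<rho>)"
    by (subst sum.reindex) (auto simp: inj_on_def)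
  then show ?thesis by (simp add: perm_mean_def)
qed

text \<open>Since the last of the first \<open>t\<close> arrivals is uniform and at most one of these \<open>t\<close> edges
  has tail \<open>v\<close> in their best orientation, \<open>v\<close> survives arrival \<open>t\<close> with probability at least
  \<open>1 - 1/t\<close>; the product telescopes.\<close>
lemma perm_mean_tail_free:
  assumes "finite S" "k \<le> card S"
  shows "(if card S = k then 1 else real k / card S) \<le>
    perm_mean S (\<lambda>\<rho>. of_bool (v \<notin> ran (marks k D \<rho>)))"
  using assms
proof (induction S rule: finite_psubset_induct)
  case (psubset S)
  let ?f = "\<lambda>\<rho>. of_bool (v \<notin> ran (marks k D \<rho>)) :: real"
  show ?case
  proof (cases "card S = k")
    case True
    have early: "length \<rho> \<le> k \<Longrightarrow> marks k D \<rho> = Map.empty" for \<rho>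
      by (induction \<rho>) (auto split: option.split)
    have "perm_mean S ?f = perm_mean S (\<lambda>_. 1)"
      using True early by (intro perm_mean_cong) (auto simp: length_finite_permutations_of_set)
    then show ?thesis using True psubset.hyps by (simp add: perm_mean_const)
  next
    case False
    with psubset.prems have k: "k \<le> card S - 1" "card S > 0" by auto
    then have ne: "S \<noteq> {}" by auto
    let ?B = "best_orientation D S"
    define T where "T = {e \<in> S. ?B e = Some v}"
    have "e = e'" if "e \<in> T" "e' \<in> T" for e e'
      using best_orientation(1)[OF psubset.hyps(1), of D] that
      unfolding T_def orientation_def inj_on_def dom_def by simp
    then have T: "card T \<le> 1"
      using psubset.hyps(1) by (auto simp: T_def card_le_Suc0_iff_eq)
    define c :: "nat \<Rightarrow> real" where "c e = (if e \<in> T then 0 else 1)" for e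
    define n where "n = card S - 1"
    define q :: real where "q = (if n = k then 1 else real k / real n)"
    have rec: "c e * q \<le> perm_mean (S - {e}) (\<lambda>\<rho>. ?f (e # \<rho>))" if e: "e \<in> S" for e
    proof (cases "e \<in> T")
      case True
      then show ?thesis by (simp add: c_def perm_mean_def sum_nonneg)
    next
      case False
      \<comment> \<open>An arrival outside \<open>T\<close> can only take a tail other than
        \<open>v\<close>.\<close>
      have "?f (e # \<rho>) \<ge> ?f \<rho>" if "\<rho> \<in> permutations_of_set (S - {e})" for \<rho>
      proof -
        have "set (e # \<rho>) = S"
          using that e by (auto simp: permutations_of_set_def)
        then show ?thesis
          using False e by (auto simp: T_def ran_def split: option.split)
      qed
      then have "perm_mean (S - {e}) ?f \<le> perm_mean (S - {e}) (\<lambda>\<rho>. ?f (e # \<rho>))"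
        by (rule perm_mean_mono)
      moreover have "S - {e} \<subset> S" using e by auto
      moreover have "card (S - {e}) = n" using e by (simp add: n_def)
      then have "q \<le> perm_mean (S - {e}) ?f"
        using psubset.IH[of "S - {e}"] \<open>S - {e} \<subset> S\<close> k unfolding q_def n_def by auto
      ultimately show ?thesis using False by (simp add: c_def)
    qed
    have "sum c S = real (card (S - T))"
      using psubset.hyps(1) unfolding c_def by (subst sum.If_cases) (auto simp: Diff_eq)
    moreover have "card (S - T) = card S - card T"
      using psubset.hyps(1) by (intro card_Diff_subset) (auto simp: T_def)
    ultimately have "real n \<le> sum c S" using T by (simp add: n_def)
    moreover have "0 \<le> q" by (simp add: q_def)
    ultimately have "real n * q \<le> sum c S * q" by (rule mult_right_mono)
    \<comment> \<open>In both cases \<open>n * q = k\<close>, which is how the product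
      telescopes.\<close>
    moreover have "real k \<le> real n * q" using k by (auto simp: q_def n_def)
    ultimately have "real k / card S \<le> (\<Sum>e\<in>S. c e * q) / card S"
      by (intro divide_right_mono) (auto simp: sum_distrib_right)
    also have "\<dots> \<le> perm_mean S ?f"
      unfolding perm_mean_rec[OF psubset.hyps(1) ne, of ?f]
      by (intro divide_right_mono sum_mono rec) auto
    finally show ?thesis using False by simp
  qed
qed

text \<open>Deleting \<open>e\<close> from a best orientation of \<open>S\<close> leaves a candidate
  for \<open>S - {e}\<close>.\<close>

lemma best_weight_remove:
  assumes "finite S" "e \<in> S"
  shows "best_weight D S - (if e \<in> dom (best_orientation D S) then obs_weight D e else 0) \<le>
    best_weight D (S - {e})"
proof -
  let ?b = "best_orientation D S"
  let ?h = "?b |` (- {e})"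
  have dom: "dom ?h = dom ?b - {e}" by auto
  have "finite (dom ?b)" using best_orientation(2)[OF assms(1)] assms(1) by (rule finite_subset)
  then have "sum (obs_weight D) (dom ?h) =
      best_weight D S - (if e \<in> dom ?b then obs_weight D e else 0)"
    unfolding dom by (simp add: sum_diff1)
  moreover have "sum (obs_weight D) (dom ?h) \<le> best_weight D (S - {e})"
  proof (rule best_orientation(3))
    show "finite (S - {e})" using assms(1) by simp
    show "orientation (obs_ends D) ?h"
      by (rule orientation_restrict) (rule best_orientation(1)[OF assms(1)])
    show "dom ?h \<subseteq> S - {e}"
      unfolding dom using best_orientation(2)[OF assms(1), of D] by blast
  qed
  ultimately show ?thesis by simp
qed

lemma best_weight_nonneg:
  assumes "finite S" "\<And>e. e \<in> S \<Longrightarrow> 0 \<le> obs_weight D e"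
  shows "0 \<le> best_weight D S"
  by (rule sum_nonneg) (rule assms(2), erule subsetD[OF best_orientation(2)[OF assms(1)]])

lemma secretary_value_nonneg: "0 \<le> secretary_value k n"
  by (auto simp: secretary_value_def intro!: divide_nonneg_nonneg sum_nonneg)

lemma secretary_value_Suc:
  assumes "k \<le> n"
  shows "Suc n * secretary_value k (Suc n) =
    n * secretary_value k n + (if n = k then 1 else real k / n)"
proof -
  have "n * secretary_value k n = (\<Sum>t=k..<n. if t = k then 1 else real k / real t)"
    by (cases "n = 0") (auto simp: secretary_value_def)
  then show ?thesis using assms by (simp add: secretary_value_def)
qed

lemma weight_marks_Cons:
  assumes "e \<notin> set \<rho>" "k \<le> length \<rho>"
  shows "sum (obs_weight D) (dom (marks k D (e # \<rho>))) = sum (obs_weight D) (dom (marks k D \<rho>)) +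
    (case best_orientation D (set (e # \<rho>)) e of None \<Rightarrow> 0
     | Some v \<Rightarrow> obs_weight D e * of_bool (v \<notin> ran (marks k D \<rho>)))"
proof -
  have "e \<notin> dom (marks k D \<rho>)" "finite (dom (marks k D \<rho>))"
    using dom_marks_subset[of k D \<rho>] assms(1) finite_subset by blast+
  then show ?thesis using assms(2) by (auto split: option.split)
qed

text \<open>Condition on the latest arrival \<open>e\<close>. The induction hypothesis covers the
  earlier ones, whose best weight drops by at most the share of \<open>e\<close>; if
  \<open>e\<close> is in the best orientation, it is marked unless its tail is taken. Averaging over
  \<open>e\<close> reproduces the recursion of \<open>secretary_value\<close>.\<close>

lemma perm_mean_weight_marks:
  assumes "finite S" "\<And>e. e \<in> S \<Longrightarrow> 0 \<le> obs_weight D e"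
  shows "secretary_value k (card S) * best_weight D S \<le>
    perm_mean S (\<lambda>\<rho>. sum (obs_weight D) (dom (marks k D \<rho>)))"
  using assms
proof (induction S rule: finite_psubset_induct)
  case (psubset S)
  let ?W = "\<lambda>\<rho>. sum (obs_weight D) (dom (marks k D \<rho>))"
  let ?b = "best_orientation D S"
  show ?case
  proof (cases "k < card S")
    case False
    have "0 \<le> ?W \<rho>" if "\<rho> \<in> permutations_of_set S" for \<rho>
      using that dom_marks_subset[of k D \<rho>] psubset.prems
      by (intro sum_nonneg) (auto simp: permutations_of_set_def)
    then have "0 \<le> perm_mean S ?W" unfolding perm_mean_def
      by (rule divide_nonneg_nonneg[OF sum_nonneg]) auto
    then show ?thesis using False by (simp add: secretary_value_def)
  next
    case True
    define n where "n = card S - 1"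
    define q :: real where "q = (if n = k then 1 else real k / n)"
    define d where "d e = (if e \<in> dom ?b then obs_weight D e else 0)" for e
    have n: "card S = Suc n" "k \<le> n" and ne: "S \<noteq> {}" using True by (auto simp: n_def)
    have d0: "0 \<le> d e" if "e \<in> S" for e using psubset.prems that by (simp add: d_def)
    have "sum d S = sum (obs_weight D) (S \<inter> dom ?b)"
      unfolding d_def using psubset.hyps(1) by (subst sum.If_cases) auto
    also have "S \<inter> dom ?b = dom ?b" using best_orientation(2)[OF psubset.hyps(1), of D] by auto
    finally have sum_d: "sum d S = best_weight D S" .
    have rec: "secretary_value k n * (best_weight D S - d e) + d e * q \<le>
        perm_mean (S - {e}) (\<lambda>\<rho>. ?W (e # \<rho>))" if e: "e \<in> S" for e
    proof -
      \<comment> \<open>Unspecified if \<open>e\<close> has no tail, but then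
        \<open>d e = 0\<close>.\<close>
      let ?v = "the (?b e)"
      have "?W (e # \<rho>) = ?W \<rho> + d e * of_bool (?v \<notin> ran (marks k D \<rho>))"
        if \<rho>: "\<rho> \<in> permutations_of_set (S - {e})" for \<rho>
      proof -
        have "set (e # \<rho>) = S" "e \<notin> set \<rho>"
          using \<rho> e by (auto simp: permutations_of_set_def)
        moreover have "k \<le> length \<rho>"
          using length_finite_permutations_of_set[OF \<rho>] e n psubset.hyps(1) by simp
        ultimately show ?thesis
          by (subst weight_marks_Cons) (auto simp: d_def split: option.split)
      qed
      then have eq: "perm_mean (S - {e}) (\<lambda>\<rho>. ?W (e # \<rho>)) = perm_mean (S - {e}) ?W +
          d e * perm_mean (S - {e}) (\<lambda>\<rho>. of_bool (?v \<notin> ran (marks k D \<rho>)))"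
        unfolding perm_mean_cmult[symmetric] perm_mean_add[symmetric]
        by (intro perm_mean_cong) auto
      have card: "card (S - {e}) = n" "S - {e} \<subset> S" using e by (auto simp: n_def)
      have "secretary_value k n * (best_weight D S - d e) \<le>
          secretary_value k n * best_weight D (S - {e})"
        unfolding d_def using best_weight_remove[OF psubset.hyps(1) e, of D]
        by (intro mult_left_mono secretary_value_nonneg)
      also have "\<dots> \<le> perm_mean (S - {e}) ?W"
        using psubset.IH[OF card(2)] psubset.prems card(1) by auto
      finally have 1: "secretary_value k n * (best_weight D S - d e) \<le> perm_mean (S - {e}) ?W" .
      have "q \<le> perm_mean (S - {e}) (\<lambda>\<rho>. of_bool (?v \<notin> ran (marks k D \<rho>)))"
        using perm_mean_tail_free[of "S - {e}" k ?v D] psubset.hyps(1) n(2)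
        unfolding card(1) q_def by simp
      from mult_left_mono[OF this d0[OF e]] 1 show ?thesis unfolding eq by simp
    qed
    have "Suc n * (secretary_value k (Suc n) * best_weight D S) =
        (n * secretary_value k n + q) * best_weight D S"
      using secretary_value_Suc[OF n(2)] by (simp add: q_def)
    \<comment> \<open>The \<open>d e\<close> sum to the best weight, so the \<open>Suc n\<close>
      differences sum to \<open>n\<close> times the best weight.\<close>
    also have "\<dots> = (\<Sum>e\<in>S. secretary_value k n * (best_weight D S - d e) + d e * q)"
      using n(1) by (simp add: sum.distrib sum_subtractf right_diff_distrib sum_d
          flip: sum_distrib_left sum_distrib_right) (simp add: algebra_simps)
    also have "\<dots> \<le> (\<Sum>e\<in>S. perm_mean (S - {e}) (\<lambda>\<rho>. ?W (e # \<rho>)))"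
      by (rule sum_mono) (rule rec)
    also have "\<dots> = Suc n * perm_mean S ?W"
      using n(1) perm_mean_rec[OF psubset.hyps(1) ne, of ?W] by simp
    finally show ?thesis unfolding n(1) by (subst (asm) mult_le_cancel_left_pos) auto
  qed
qed

section \<open>Acceptance of marked edges\<close>

definition closes_cycle :: "(nat \<Rightarrow> 'v \<times> 'v) \<Rightarrow> nat set \<Rightarrow> nat \<Rightarrow> bool" where
  "closes_cycle ends F e \<longleftrightarrow> (\<exists>es vs. is_cycle ends es vs \<and> e \<in> set es \<and> set es \<subseteq> F)"

text \<open>Decides only the head of the list, the latest arrival. The cycle test refers to marked
  rather than accepted edges, so the arrival order alone determines which edges rely on their
  coins.\<close>

fun wants :: "nat \<Rightarrow> (nat \<Rightarrow> 'v obs) \<Rightarrow> (nat \<Rightarrow> bool) \<Rightarrow> nat list \<Rightarrow> bool" where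
  "wants k D c [] \<longleftrightarrow> False"
| "wants k D c (e # \<rho>) \<longleftrightarrow> e \<in> dom (marks k D (e # \<rho>)) \<and>
     (c e \<or> closes_cycle (obs_ends D) (dom (marks k D (e # \<rho>))) e)"

fun accepted :: "nat \<Rightarrow> (nat \<Rightarrow> 'v obs) \<Rightarrow> (nat \<Rightarrow> bool) \<Rightarrow> nat list \<Rightarrow> nat set" where
  "accepted k D c [] = {}"
| "accepted k D c (e # \<rho>) =
     (if wants k D c (e # \<rho>) \<and> acyclic_edges (obs_ends D) (insert e (accepted k D c \<rho>))
      then insert e (accepted k D c \<rho>) else accepted k D c \<rho>)"

lemma is_cycle_cong:
  "(\<And>e. e \<in> set es \<Longrightarrow> ends e = ends' e) \<Longrightarrow> is_cycle ends es vs \<longleftrightarrow> is_cycle ends' es vs"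
  by (simp add: is_cycle_def)

lemma closes_cycle_cong:
  "(\<And>e. e \<in> F \<Longrightarrow> ends e = ends' e) \<Longrightarrow> closes_cycle ends F e \<longleftrightarrow> closes_cycle ends' F e"
  unfolding closes_cycle_def by (metis is_cycle_cong subsetD)

lemma wants_cong:
  assumes "\<And>e. e \<in> set \<rho> \<Longrightarrow> D e = D' e"
  shows "wants k D c \<rho> \<longleftrightarrow> wants k D' c \<rho>"
proof (cases \<rho>)
  case (Cons e \<rho>')
  have "marks k D \<rho> = marks k D' \<rho>" using assms by (rule marks_cong)
  moreover have "closes_cycle (obs_ends D) (dom (marks k D' \<rho>)) e \<longleftrightarrow>
      closes_cycle (obs_ends D') (dom (marks k D' \<rho>)) e"
    using assms dom_marks_subset[of k D' \<rho>] by (intro closes_cycle_cong) auto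
  ultimately show ?thesis using Cons by (simp del: marks.simps)
qed simp

lemma dom_marks_Cons:
  assumes "distinct (e # \<rho>)"
  shows "dom (marks k D \<rho>) \<subseteq> dom (marks k D (e # \<rho>))"
  using dom_marks_append[of "[e]" \<rho> k D] assms by (simp del: marks.simps)

lemma accepted_subset_marks:
  "distinct \<rho> \<Longrightarrow> accepted k D c \<rho> \<subseteq> dom (marks k D \<rho>)"
proof (induction \<rho>)
  case (Cons e \<rho>)
  then have "accepted k D c \<rho> \<subseteq> dom (marks k D (e # \<rho>))"
    using dom_marks_Cons[OF Cons.prems, of k D] by auto
  then show ?case by (auto simp del: marks.simps)
qed simp

lemma acyclic_accepted: "acyclic_edges (obs_ends D) (accepted k D c \<rho>)"
  by (induction \<rho>) (auto simp: acyclic_edges_def is_cycle_def)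

lemma accepted_append_other:
  "e \<notin> set \<rho>' \<Longrightarrow> e \<in> accepted k D c (\<rho>' @ \<rho>) \<longleftrightarrow> e \<in> accepted k D c \<rho>"
  by (induction \<rho>') (auto simp del: wants.simps)

text \<open>Accepted edges are marked, so a cycle that \<open>e\<close> closes with accepted edges
  would be a cycle of marked edges.\<close>

lemma accepted_if_not_closes_cycle:
  assumes "distinct (e # \<rho>)" "e \<in> dom (marks k D (e # \<rho>))"
    and "\<not> closes_cycle (obs_ends D) (dom (marks k D (e # \<rho>))) e" "c e"
  shows "e \<in> accepted k D c (e # \<rho>)"
proof -
  have "accepted k D c \<rho> \<subseteq> dom (marks k D (e # \<rho>))"
    using accepted_subset_marks[of \<rho> k D c] dom_marks_Cons[OF assms(1), of k D] assms(1) by auto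
  then have "insert e (accepted k D c \<rho>) \<subseteq> dom (marks k D (e # \<rho>))" using assms(2) by auto
  then have "acyclic_edges (obs_ends D) (insert e (accepted k D c \<rho>))"
    using assms(3) acyclic_accepted[of D k c \<rho>] unfolding acyclic_edges_def closes_cycle_def
    by (metis insertE subset_iff)
  then show ?thesis using assms(2,4) by (simp del: marks.simps)
qed

text \<open>Cycles of marked edges are disjoint, so on a cycle only the edge that arrives last
  ignores its coin.\<close>
lemma coins_if_cycle_edge_rejected:
  assumes d: "distinct (e # \<rho>)" and c: "is_cycle (obs_ends D) es vs"
    and es: "e \<in> set es" "set es \<subseteq> dom (marks k D (e # \<rho>))"
    and rej: "e \<notin> accepted k D c (e # \<rho>)" and e': "e' \<in> set es" "e' \<noteq> e"
  shows "c e'"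
proof -
  let ?M = "marks k D (e # \<rho>)"
  have sub: "accepted k D c \<rho> \<subseteq> dom (marks k D \<rho>)" "dom (marks k D \<rho>) \<subseteq> dom ?M"
    using accepted_subset_marks[of \<rho> k D c] dom_marks_Cons[OF d, of k D] d by auto
  have uniq: "set es' = set es"
    if "is_cycle (obs_ends D) es' vs'" "set es' \<subseteq> dom ?M" "a \<in> set es'" "a \<in> set es" for es' vs' a
    using oriented_cycle_unique[OF orientation_marks that(1,2) c es(2) that(3,4)] .
  \<comment> \<open>On its cycle \<open>e\<close> is wanted whatever its coin, so only infeasibility
    can explain the rejection.\<close>
  have "wants k D c (e # \<rho>)"
    using es c by (auto simp: closes_cycle_def simp del: marks.simps)
  then have "\<not> acyclic_edges (obs_ends D) (insert e (accepted k D c \<rho>))"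
    using rej by (auto simp del: wants.simps)
  then obtain es' vs' where es': "is_cycle (obs_ends D) es' vs'" "set es' \<subseteq> insert e (accepted k D c \<rho>)"
    by (auto simp: acyclic_edges_def)
  then have "e \<in> set es'"
    using acyclic_accepted[of D k c \<rho>] by (auto simp: acyclic_edges_def)
  moreover have "set es' \<subseteq> dom ?M" using es'(2) sub es(1,2) by blast
  \<comment> \<open>The blocking cycle must be the given one, so all of its other edges were
    accepted.\<close>
  ultimately have "set es' = set es" using uniq[OF es'(1)] es(1) by auto
  then have acc: "e' \<in> accepted k D c \<rho>" using es'(2) e' by auto
  then have "e' \<in> set \<rho>" using sub(1) dom_marks_subset[of k D \<rho>] by auto
  then obtain \<rho>' \<rho>'' where \<rho>: "\<rho> = \<rho>' @ e' # \<rho>''" by (auto simp: in_set_conv_decomp)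
  with d acc have "e' \<in> accepted k D c (e' # \<rho>'')"
    by (auto simp: accepted_append_other simp del: accepted.simps)
  moreover have "e' \<notin> accepted k D c \<rho>''"
    using accepted_subset_marks[of \<rho>'' k D c] dom_marks_subset[of k D \<rho>''] d \<rho> by auto
  ultimately have w: "wants k D c (e' # \<rho>'')"
    by (simp del: wants.simps split: if_splits)
  \<comment> \<open>Without a successful coin, \<open>e'\<close> would have closed a marked cycle on
    arrival. That cycle shares \<open>e'\<close> with \<open>es\<close> and hence equals it,
    although \<open>e\<close> had not yet arrived.\<close>
  show "c e'"
  proof (rule ccontr)
    assume "\<not> c e'"
    with w obtain es'' vs'' where es'': "is_cycle (obs_ends D) es'' vs''" "e' \<in> set es''"
      "set es'' \<subseteq> dom (marks k D (e' # \<rho>''))"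
      by (auto simp: closes_cycle_def simp del: marks.simps)
    moreover have "dom (marks k D (e' # \<rho>'')) \<subseteq> dom (marks k D \<rho>)"
      unfolding \<rho> using d \<rho> by (intro dom_marks_append) auto
    ultimately have "set es'' = set es" using sub(2) uniq[OF es''(1)] e'(1) by blast
    moreover have "e \<notin> set es''"
      using es''(3) dom_marks_subset[of k D "e' # \<rho>''"] d \<rho> by auto
    ultimately show False using es(1) by simp
  qed
qed

section \<open>Acceptance probabilities over independent coins\<close>

abbreviation coins :: "real \<Rightarrow> nat set \<Rightarrow> (nat \<Rightarrow> bool) pmf" where
  "coins x I \<equiv> Pi_pmf I False (\<lambda>_. bernoulli_pmf x)"

lemma finite_set_pmf_coins: "finite I \<Longrightarrow> finite (set_pmf (coins x I))"
  by (simp add: set_Pi_pmf finite_PiE_dflt)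

lemma prob_coins:
  assumes "finite I" "A \<subseteq> I" "0 \<le> x" "x \<le> 1"
  shows "measure_pmf.prob (coins x I) {c. \<forall>e\<in>A. c e} = x ^ card A"
proof -
  have "{c. \<forall>e\<in>A. c e} = Pi I (\<lambda>e. if e \<in> A then {True} else UNIV)"
    using assms(2) by (auto simp: Pi_def split: if_splits)
  then have "measure_pmf.prob (coins x I) {c. \<forall>e\<in>A. c e} =
      (\<Prod>e\<in>I. measure_pmf.prob (bernoulli_pmf x) (if e \<in> A then {True} else UNIV))"
    using assms(1) by (simp add: measure_Pi_pmf_Pi)
  also have "\<dots> = (\<Prod>e\<in>I. if e \<in> A then x else 1)"
    using assms(3,4) by (intro prod.cong) (auto simp: measure_pmf_single)
  also have "\<dots> = x ^ card A"
    using assms(1,2) by (simp add: prod.If_cases Int_absorb1)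
  finally show ?thesis .
qed

text \<open>The order is fixed and only the coins are random. If \<open>e\<close> closes no marked
  cycle, its coin suffices. If it closes one, rejection needs the success of at least
  \<open>g - 1\<close> other coins, which has probability at most
  \<open>x ^ (g - 1) = 1 - x\<close>.\<close>

lemma prob_accepted:
  assumes I: "finite I" "set \<rho> \<subseteq> I" and d: "distinct \<rho>" and x: "0 \<le> x" "x \<le> 1"
    and root: "x ^ (g - 1) = 1 - x"
    and girth: "\<And>es vs. is_cycle (obs_ends D) es vs \<Longrightarrow> set es \<subseteq> I \<Longrightarrow> g \<le> length es"
    and e: "e \<in> dom (marks k D \<rho>)"
  shows "x \<le> measure_pmf.prob (coins x I) {c. e \<in> accepted k D c \<rho>}"
proof -
  have "e \<in> set \<rho>" using e dom_marks_subset[of k D \<rho>] by auto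
  then obtain \<rho>' \<rho>'' where \<rho>: "\<rho> = \<rho>' @ e # \<rho>''" by (auto simp: in_set_conv_decomp)
  then have d': "distinct (e # \<rho>'')" "e \<notin> set \<rho>'" using d by auto
  have acc: "e \<in> accepted k D c \<rho> \<longleftrightarrow> e \<in> accepted k D c (e # \<rho>'')" for c
    unfolding \<rho> using d'(2) by (rule accepted_append_other)
  let ?M = "marks k D (e # \<rho>'')"
  have eM: "e \<in> dom ?M"
    using e marks_append_other[OF d'(2), of k D "e # \<rho>''"] by (simp add: \<rho> dom_def)
  show ?thesis
  proof (cases "closes_cycle (obs_ends D) (dom ?M) e")
    case False
    have "x = measure_pmf.prob (coins x I) {c. \<forall>a\<in>{e}. c a}"
      using \<open>e \<in> set \<rho>\<close> I x by (subst prob_coins) auto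
    also have "\<dots> \<le> measure_pmf.prob (coins x I) {c. e \<in> accepted k D c \<rho>}"
      using accepted_if_not_closes_cycle[OF d'(1) eM False]
      by (intro measure_pmf.finite_measure_mono) (auto simp: acc simp del: accepted.simps)
    finally show ?thesis .
  next
    case True
    then obtain es vs where es: "is_cycle (obs_ends D) es vs" "e \<in> set es" "set es \<subseteq> dom ?M"
      by (auto simp: closes_cycle_def)
    have esI: "set es \<subseteq> I" using es(3) dom_marks_subset[of k D "e # \<rho>''"] I(2) \<rho> by auto
    have "distinct es" using es(1) by (simp add: is_cycle_def)
    then have "card (set es - {e}) = length es - 1" using es(2) by (simp add: distinct_card)
    moreover have "g \<le> length es" using girth[OF es(1) esI] .
    ultimately have "x ^ card (set es - {e}) \<le> x ^ (g - 1)"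
      using x by (intro power_decreasing) auto
    moreover have "measure_pmf.prob (coins x I) {c. e \<notin> accepted k D c \<rho>} \<le>
        measure_pmf.prob (coins x I) {c. \<forall>a\<in>set es - {e}. c a}"
      using coins_if_cycle_edge_rejected[OF d'(1) es]
      by (intro measure_pmf.finite_measure_mono) (auto simp: acc simp del: accepted.simps)
    moreover have "measure_pmf.prob (coins x I) {c. \<forall>a\<in>set es - {e}. c a} = x ^ card (set es - {e})"
      using esI I x by (intro prob_coins) auto
    moreover have "measure_pmf.prob (coins x I) {c. e \<notin> accepted k D c \<rho>} =
        1 - measure_pmf.prob (coins x I) {c. e \<in> accepted k D c \<rho>}"
      using measure_pmf.prob_compl[of "{c. e \<in> accepted k D c \<rho>}" "coins x I"]
      by (simp add: Collect_neg_eq Compl_eq_Diff_UNIV)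
    ultimately show ?thesis using root by linarith
  qed
qed

lemma expectation_weight_accepted:
  assumes I: "finite I" "set \<rho> \<subseteq> I" and d: "distinct \<rho>" and x: "0 \<le> x" "x \<le> 1"
    and root: "x ^ (g - 1) = 1 - x"
    and girth: "\<And>es vs. is_cycle (obs_ends D) es vs \<Longrightarrow> set es \<subseteq> I \<Longrightarrow> g \<le> length es"
    and w: "\<And>e. e \<in> I \<Longrightarrow> 0 \<le> obs_weight D e"
  shows "x * sum (obs_weight D) (dom (marks k D \<rho>)) \<le>
    measure_pmf.expectation (coins x I) (\<lambda>c. sum (obs_weight D) (accepted k D c \<rho>))"
proof -
  let ?M = "dom (marks k D \<rho>)" and ?C = "coins x I"
  have M: "?M \<subseteq> I" using dom_marks_subset[of k D \<rho>] I by auto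
  then have fin: "finite ?M" using I(1) finite_subset by auto
  have acc: "sum (obs_weight D) (accepted k D c \<rho>) =
      (\<Sum>e\<in>?M. obs_weight D e * indicator {c. e \<in> accepted k D c \<rho>} c)" for c
  proof -
    have "(\<Sum>e\<in>?M. obs_weight D e * indicator {c. e \<in> accepted k D c \<rho>} c) =
        (\<Sum>e\<in>?M. if e \<in> accepted k D c \<rho> then obs_weight D e else 0)"
      by (intro sum.cong) auto
    also have "\<dots> = sum (obs_weight D) (?M \<inter> accepted k D c \<rho>)"
      using fin by (simp add: sum.inter_restrict)
    finally show ?thesis
      using accepted_subset_marks[OF d, of k D c] by (simp add: Int_absorb1)
  qed
  have "x * sum (obs_weight D) ?M = (\<Sum>e\<in>?M. obs_weight D e * x)"
    by (simp add: sum_distrib_left mult.commute)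
  also have "\<dots> \<le> (\<Sum>e\<in>?M. obs_weight D e * measure_pmf.prob ?C {c. e \<in> accepted k D c \<rho>})"
    using M w by (intro sum_mono mult_left_mono prob_accepted[OF I d x root girth]) auto
  also have "\<dots> = measure_pmf.expectation ?C
      (\<lambda>c. \<Sum>e\<in>?M. obs_weight D e * indicator {c. e \<in> accepted k D c \<rho>} c)"
    using finite_set_pmf_coins[OF I(1)]
    by (subst Bochner_Integration.integral_sum) (auto intro!: integrable_measure_pmf_finite)
  finally show ?thesis by (simp only: acc)
qed

section \<open>The online algorithm\<close>

text \<open>The policy does not see edge identities. It calls the \<open>t\<close>-th arrival \<open>\<sigma> ! t\<close> for a random
  \<open>\<sigma>\<close>, which breaks ties independently of the arrival order even between indistinguishable edges.\<close>
definition policy :: "nat \<Rightarrow> nat list \<Rightarrow> (nat \<Rightarrow> bool) \<Rightarrow> 'v policy" where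
  "policy k \<sigma> c hist ob =
     wants k (\<lambda>e. the (map_of (zip \<sigma> (map fst hist @ [ob])) e)) c
       (rev (take (Suc (length hist)) \<sigma>))"

abbreviation edge_obs :: "(nat \<Rightarrow> 'v \<times> 'v) \<Rightarrow> (nat \<Rightarrow> real) \<Rightarrow> nat \<Rightarrow> 'v obs" where
  "edge_obs ends w \<equiv> \<lambda>e. (fst (ends e), snd (ends e), w e)"

text \<open>The lookup table agrees with \<open>D\<close> on all names given out so far, and by
  \<open>wants_cong\<close> no other value matters.\<close>

lemma policy_eq_wants:
  assumes "map fst hist = map D \<sigma>1"
  shows "policy k (\<sigma>1 @ e # \<sigma>2) c hist (D e) \<longleftrightarrow> wants k D c (e # rev \<sigma>1)"
proof -
  let ?\<sigma> = "\<sigma>1 @ [e]"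
  have len: "length hist = length \<sigma>1" using assms by (metis length_map)
  \<comment> \<open>\<open>zip\<close> stops at the shorter list, so the names
    \<open>\<sigma>2\<close> not yet given out disappear.\<close>
  have "zip (?\<sigma> @ \<sigma>2) (map D ?\<sigma> @ []) = zip ?\<sigma> (map D ?\<sigma>)"
    by (subst zip_append) auto
  then have "zip (\<sigma>1 @ e # \<sigma>2) (map fst hist @ [D e]) = zip ?\<sigma> (map D ?\<sigma>)"
    using assms by simp
  then have "policy k (\<sigma>1 @ e # \<sigma>2) c hist (D e) \<longleftrightarrow>
      wants k (\<lambda>a. the (map_of (zip ?\<sigma> (map D ?\<sigma>)) a)) c (e # rev \<sigma>1)"
    unfolding policy_def by (simp add: len)
  also have "\<dots> \<longleftrightarrow> wants k D c (e # rev \<sigma>1)"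
    by (intro wants_cong) (auto simp: map_of_zip_map simp del: map_append)
  finally show ?thesis .
qed

lemma run_aux_policy:
  assumes "map fst hist = map (edge_obs ends w) \<sigma>1"
  shows "run_aux ends w (policy k (\<sigma>1 @ \<sigma>2) c) hist (accepted k (edge_obs ends w) c (rev \<sigma>1)) \<sigma>2 =
    accepted k (edge_obs ends w) c (rev (\<sigma>1 @ \<sigma>2))"
  using assms
proof (induction \<sigma>2 arbitrary: \<sigma>1 hist)
  case (Cons e \<sigma>2)
  let ?D = "edge_obs ends w"
  define acc where "acc \<longleftrightarrow> policy k (\<sigma>1 @ e # \<sigma>2) c hist (?D e) \<and>
    acyclic_edges ends (insert e (accepted k ?D c (rev \<sigma>1)))"
  have "accepted k ?D c (rev (\<sigma>1 @ [e])) =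
      (if acc then insert e (accepted k ?D c (rev \<sigma>1)) else accepted k ?D c (rev \<sigma>1))"
    using policy_eq_wants[OF Cons.prems, of k e \<sigma>2 c] by (simp add: acc_def del: wants.simps)
  moreover have "map fst (hist @ [(?D e, acc)]) = map ?D (\<sigma>1 @ [e])" using Cons.prems by simp
  from Cons.IH[OF this] have "run_aux ends w (policy k (\<sigma>1 @ e # \<sigma>2) c) (hist @ [(?D e, acc)])
      (accepted k ?D c (rev (\<sigma>1 @ [e]))) \<sigma>2 = accepted k ?D c (rev (\<sigma>1 @ e # \<sigma>2))"
    by simp
  ultimately show ?case by (simp add: acc_def Let_def del: accepted.simps)
qed simp

text \<open>Here the arrival order coincides with the names \<open>\<sigma>\<close> of the policy;
  other orders are reduced to this case by relabelling.\<close>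

lemma run_policy: "run ends w (policy k \<sigma> c) \<sigma> = accepted k (edge_obs ends w) c (rev \<sigma>)"
  using run_aux_policy[of "[]" ends w "[]" k \<sigma> c] by (simp add: run_def)

section \<open>Relabelling of the edges\<close>

lemma is_cycle_map:
  assumes "inj \<pi>"
  shows "is_cycle (ends \<circ> \<pi>) es vs \<longleftrightarrow> is_cycle ends (map \<pi> es) vs"
  using inj_on_subset[OF assms subset_UNIV] by (auto simp: is_cycle_def distinct_map)

lemma acyclic_edges_image:
  assumes "bij \<pi>"
  shows "acyclic_edges ends (\<pi> ` F) \<longleftrightarrow> acyclic_edges (ends \<circ> \<pi>) F"
proof -
  have inj: "inj \<pi>" using assms by (rule bij_is_inj)
  have "(\<exists>es vs. is_cycle ends es vs \<and> set es \<subseteq> \<pi> ` F) \<longleftrightarrow>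
      (\<exists>es vs. is_cycle ends (map \<pi> es) vs \<and> set es \<subseteq> F)" (is "?L \<longleftrightarrow> ?R")
  proof
    assume ?L
    then obtain es vs where "is_cycle ends es vs" "set es \<subseteq> \<pi> ` F" by blast
    moreover from this(2) have "es \<in> lists (\<pi> ` F)" by auto
    then obtain es' where "es = map \<pi> es'" "es' \<in> lists F" by (auto simp: lists_image)
    ultimately show ?R by auto
  next
    assume ?R
    then show ?L by (metis image_mono list.set_map)
  qed
  then show ?thesis by (simp add: acyclic_edges_def is_cycle_map[OF inj])
qed

text \<open>A policy sees observations only, so renaming the edges renames the accepted set and
  changes nothing else.\<close>

lemma run_aux_map:
  assumes "bij \<pi>"
  shows "run_aux ends w P hist (\<pi> ` F) (map \<pi> \<sigma>) = \<pi> ` run_aux (ends \<circ> \<pi>) (w \<circ> \<pi>) P hist F \<sigma>"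
proof (induction \<sigma> arbitrary: hist F)
  case (Cons e \<sigma>)
  have "acyclic_edges ends (insert (\<pi> e) (\<pi> ` F)) \<longleftrightarrow> acyclic_edges (ends \<circ> \<pi>) (insert e F)"
    using acyclic_edges_image[OF assms, of ends "insert e F"] by simp
  then show ?case
    using Cons.IH[of _ F] Cons.IH[of _ "insert e F"] by (simp add: Let_def comp_def)
qed simp

lemma sum_run_map:
  assumes "bij \<pi>"
  shows "sum w (run ends w P (map \<pi> \<sigma>)) = sum (w \<circ> \<pi>) (run (ends \<circ> \<pi>) (w \<circ> \<pi>) P \<sigma>)"
proof -
  have "run ends w P (map \<pi> \<sigma>) = \<pi> ` run (ends \<circ> \<pi>) (w \<circ> \<pi>) P \<sigma>"
    using run_aux_map[OF assms, of ends w P "[]" "{}" \<sigma>] by (simp add: run_def)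
  then show ?thesis
    using inj_on_subset[OF bij_is_inj[OF assms] subset_UNIV] by (simp add: sum.reindex)
qed

lemma bij_betw_permutes_permutations_of_set:
  assumes "finite S" "\<sigma> \<in> permutations_of_set S"
  shows "bij_betw (\<lambda>\<pi>. map \<pi> \<sigma>) {\<pi>. \<pi> permutes S} (permutations_of_set S)"
proof -
  have \<sigma>: "set \<sigma> = S" using assms(2) by (simp add: permutations_of_set_def)
  have inj: "inj_on (\<lambda>\<pi>. map \<pi> \<sigma>) {\<pi>. \<pi> permutes S}"
  proof (rule inj_onI, rule ext)
    fix \<pi> \<pi>' x assume *: "\<pi> \<in> {\<pi>. \<pi> permutes S}" "\<pi>' \<in> {\<pi>. \<pi> permutes S}" "map \<pi> \<sigma> = map \<pi>' \<sigma>"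
    then show "\<pi> x = \<pi>' x"
      using \<sigma> by (cases "x \<in> S") (auto simp: permutes_not_in)
  qed
  moreover have "(\<lambda>\<pi>. map \<pi> \<sigma>) ` {\<pi>. \<pi> permutes S} = permutations_of_set S"
  proof (rule card_subset_eq)
    show "(\<lambda>\<pi>. map \<pi> \<sigma>) ` {\<pi>. \<pi> permutes S} \<subseteq> permutations_of_set S"
      using permutations_of_set_image_permutes[of _ S] assms(2) by blast
    show "card ((\<lambda>\<pi>. map \<pi> \<sigma>) ` {\<pi>. \<pi> permutes S}) = card (permutations_of_set S)"
      using card_image[OF inj] card_permutations[OF refl assms(1)] assms(1) by simp
  qed simp
  ultimately show ?thesis by (simp add: bij_betw_def)
qed

text \<open>Two independent uniform orders \<open>\<sigma>\<close>, \<open>p\<close> amount to a uniform relabelling \<open>\<pi>\<close> with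
  \<open>p = map \<pi> \<sigma>\<close> and an independent uniform order \<open>\<sigma>\<close>.\<close>
lemma perm_mean_relabel:
  assumes "finite S"
  shows "perm_mean S (\<lambda>\<sigma>. perm_mean S (H \<sigma>)) =
    (\<Sum>\<pi> | \<pi> permutes S. perm_mean S (\<lambda>\<sigma>. H \<sigma> (map \<pi> \<sigma>))) / fact (card S)"
proof -
  have "(\<Sum>p\<in>permutations_of_set S. H \<sigma> p) = (\<Sum>\<pi> | \<pi> permutes S. H \<sigma> (map \<pi> \<sigma>))"
    if "\<sigma> \<in> permutations_of_set S" for \<sigma>
    using sum.reindex_bij_betw[OF bij_betw_permutes_permutations_of_set[OF assms that]] by metis
  then have "perm_mean S (\<lambda>\<sigma>. perm_mean S (H \<sigma>)) =
      (\<Sum>\<sigma>\<in>permutations_of_set S. (\<Sum>\<pi> | \<pi> permutes S. H \<sigma> (map \<pi> \<sigma>)) / fact (card S)) / fact (card S)"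
    by (simp add: perm_mean_def)
  also have "\<dots> = (\<Sum>\<sigma>\<in>permutations_of_set S. \<Sum>\<pi> | \<pi> permutes S. H \<sigma> (map \<pi> \<sigma>)) / fact (card S) / fact (card S)"
    by (simp add: sum_divide_distrib)
  also have "\<dots> = (\<Sum>\<pi> | \<pi> permutes S. perm_mean S (\<lambda>\<sigma>. H \<sigma> (map \<pi> \<sigma>))) / fact (card S)"
    by (subst sum.swap) (simp add: perm_mean_def sum_divide_distrib)
  finally show ?thesis .
qed

section \<open>Comparison with the optimum\<close>

lemma OPT_attained:
  obtains F where "F \<subseteq> {0..<m}" "acyclic_edges ends F" "OPT m ends w = sum w F"
proof -
  let ?X = "{sum w F | F. F \<subseteq> {0..<m} \<and> acyclic_edges ends F}"
  have "?X \<subseteq> sum w ` Pow {0..<m}" by auto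
  then have "finite ?X" by (rule finite_subset) auto
  moreover have "acyclic_edges ends {}" by (auto simp: acyclic_edges_def is_cycle_def)
  then have "?X \<noteq> {}" by blast
  ultimately have "OPT m ends w \<in> ?X" unfolding OPT_def by (rule Max_in)
  then show thesis using that by blast
qed

text \<open>A maximum-weight forest is orientable and so competes for the best orientation; its
  orientation is pulled back along \<open>\<pi>\<close>.\<close>

lemma OPT_le_best_weight:
  assumes "multigraph V m ends" "\<pi> permutes {0..<m}"
  shows "OPT m ends w \<le> best_weight (edge_obs (ends \<circ> \<pi>) (w \<circ> \<pi>)) {0..<m}"
proof -
  let ?D = "edge_obs (ends \<circ> \<pi>) (w \<circ> \<pi>)"
  obtain F where F: "F \<subseteq> {0..<m}" "acyclic_edges ends F" "OPT m ends w = sum w F"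
    by (rule OPT_attained)
  have "finite F" using F(1) finite_subset by auto
  moreover have "\<And>e. e \<in> F \<Longrightarrow> fst (ends e) \<noteq> snd (ends e)"
    using F(1) assms(1) by (auto simp: multigraph_def)
  ultimately obtain h where h: "orientation ends h" "dom h = F"
    using acyclic_orientation[OF _ _ F(2)] by blast
  have inj: "inj \<pi>" using assms(2) by (rule permutes_inj)
  have dom: "dom (h \<circ> \<pi>) = \<pi> -` F" using h(2) by (auto simp: dom_def)
  have im: "\<pi> ` (\<pi> -` F) = F" using permutes_surj[OF assms(2)] by (rule surj_image_vimage_eq)
  have "orientation (obs_ends ?D) (h \<circ> \<pi>)"
    using h(1) inj unfolding orientation_def inj_on_def inj_def by (auto simp: dom_def)
  moreover have "dom (h \<circ> \<pi>) \<subseteq> {0..<m}"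
    using F(1) permutes_in_image[OF assms(2)] unfolding dom by auto
  ultimately have "sum (obs_weight ?D) (dom (h \<circ> \<pi>)) \<le> best_weight ?D {0..<m}"
    by (intro best_orientation(3)) auto
  moreover have "sum (obs_weight ?D) (dom (h \<circ> \<pi>)) = sum w F"
    unfolding dom using sum.reindex[of \<pi> "\<pi> -` F" w] inj im by (simp add: inj_on_subset comp_def)
  ultimately show ?thesis using F(3) by simp
qed

text \<open>The sampling length depends on \<open>m\<close> alone. Names and coins are drawn in
  advance, because a randomized algorithm is a distribution over policies.\<close>

definition algorithm :: "real \<Rightarrow> 'v algorithm" where
  "algorithm x V m = do {
     \<sigma> \<leftarrow> pmf_of_set (permutations_of_set {0..<m});
     c \<leftarrow> coins x {0..<m};
     return_pmf (policy (SOME k. secretary_value k m \<ge> 1 / exp 1) \<sigma> c)}"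

lemma expected_ALG_algorithm:
  fixes m :: nat and ends :: "nat \<Rightarrow> 'v \<times> 'v"
  defines "k \<equiv> (SOME k. secretary_value k m \<ge> 1 / exp 1)"
  shows "expected_ALG (algorithm x) V m ends w = perm_mean {0..<m} (\<lambda>\<sigma>. perm_mean {0..<m} (\<lambda>p.
    measure_pmf.expectation (coins x {0..<m}) (\<lambda>c. sum w (run ends w (policy k \<sigma> c) p))))"
proof -
  let ?S = "permutations_of_set {0..<m}"
  define R where "R \<sigma> p c = run ends w (policy k \<sigma> c) p" for \<sigma> p c
  have fin: "finite (set_pmf (coins x {0..<m}))" by (rule finite_set_pmf_coins) simp
  \<comment> \<open>Coins and arrival order are independent, so the coins can be drawn last, with
    both orders fixed.\<close>
  have eq: "(algorithm x V m \<bind> (\<lambda>P. pmf_of_set ?S \<bind> (\<lambda>p. return_pmf (run ends w P p)))) =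
      pmf_of_set ?S \<bind> (\<lambda>\<sigma>. pmf_of_set ?S \<bind> (\<lambda>p. map_pmf (R \<sigma> p) (coins x {0..<m})))"
    unfolding algorithm_def k_def[symmetric] bind_assoc_pmf bind_return_pmf map_pmf_def R_def
    by (intro bind_pmf_cong refl) (rule bind_commute_pmf)
  have "expected_ALG (algorithm x) V m ends w = measure_pmf.expectation
      (pmf_of_set ?S \<bind> (\<lambda>\<sigma>. pmf_of_set ?S \<bind> (\<lambda>p. map_pmf (R \<sigma> p) (coins x {0..<m})))) (sum w)"
    unfolding expected_ALG_def eq ..
  also have "\<dots> = perm_mean {0..<m} (\<lambda>\<sigma>. perm_mean {0..<m} (\<lambda>p.
      measure_pmf.expectation (map_pmf (R \<sigma> p) (coins x {0..<m})) (sum w)))"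
    using fin by (simp add: pmf_expectation_bind_pmf_of_set perm_mean_def divide_inverse
        sum_distrib_left sum_distrib_right mult.commute)
  finally show ?thesis by (simp add: R_def)
qed

text \<open>For each relabelling \<open>\<pi>\<close> the names become the arrival order of an
  instance with the same girth bound and with best weight at least \<open>OPT\<close>. In
  expectation marking keeps a fraction \<open>1 / exp 1\<close> of it and acceptance a fraction
  \<open>x\<close> of that; averaging over \<open>\<pi>\<close> finishes.\<close>

lemma algorithm_competitive:
  fixes ends :: "nat \<Rightarrow> 'v \<times> 'v"
  assumes G: "multigraph V m ends" and w: "\<And>e. e < m \<Longrightarrow> 0 \<le> w e" and girth: "girth_ge m ends g"
    and x: "0 \<le> x" "x \<le> 1" "x ^ (g - 1) = 1 - x"
  shows "x / exp 1 * OPT m ends w \<le> expected_ALG (algorithm x) V m ends w"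
proof -
  let ?S = "{0..<m}" and ?L = "x / exp 1 * OPT m ends w"
  define k where "k = (SOME k. secretary_value k m \<ge> 1 / exp 1)"
  define H where "H \<sigma> p = measure_pmf.expectation (coins x ?S)
    (\<lambda>c. sum w (run ends w (policy k \<sigma> c) p))" for \<sigma> p
  have "?L \<le> perm_mean ?S (\<lambda>\<sigma>. H \<sigma> (map \<pi> \<sigma>))" if \<pi>: "\<pi> permutes ?S" for \<pi>
  proof -
    let ?D = "edge_obs (ends \<circ> \<pi>) (w \<circ> \<pi>)"
    let ?W = "\<lambda>\<rho>. sum (obs_weight ?D) (dom (marks k ?D \<rho>))"
    have bij: "bij \<pi>" using \<pi> by (rule permutes_bij)
    have \<pi>_in: "\<pi> e \<in> ?S \<longleftrightarrow> e \<in> ?S" for e using permutes_in_image[OF \<pi>] .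
    have w': "0 \<le> obs_weight ?D e" if "e \<in> ?S" for e using w[of "\<pi> e"] \<pi>_in[of e] that by simp
    have girth': "g \<le> length es" if "is_cycle (obs_ends ?D) es vs" "set es \<subseteq> ?S" for es vs
    proof -
      have "is_cycle ends (map \<pi> es) vs"
        using that(1) is_cycle_map[OF bij_is_inj[OF bij], of ends es vs] by (simp add: comp_def)
      moreover have "set (map \<pi> es) \<subseteq> ?S" using that(2) \<pi>_in by auto
      ultimately show ?thesis using girth unfolding girth_ge_def by (metis length_map)
    qed
    have H: "x * ?W (rev \<sigma>) \<le> H \<sigma> (map \<pi> \<sigma>)" if "\<sigma> \<in> permutations_of_set ?S" for \<sigma>
    proof -
      have "x * ?W (rev \<sigma>) \<le> measure_pmf.expectation (coins x ?S)
          (\<lambda>c. sum (obs_weight ?D) (accepted k ?D c (rev \<sigma>)))"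
        using that by (intro expectation_weight_accepted[OF _ _ _ x girth' w'])
          (auto simp: permutations_of_set_def)
      then show ?thesis by (simp add: H_def sum_run_map[OF bij] run_policy)
    qed
    have bw: "0 \<le> best_weight ?D ?S" using w' by (intro best_weight_nonneg) auto
    have sv: "1 / exp 1 * best_weight ?D ?S \<le> secretary_value k m * best_weight ?D ?S"
    \<comment> \<open>For \<open>m = 0\<close> no \<open>k\<close> reaches \<open>1 / exp 1\<close>
      and the choice of \<open>k\<close> is arbitrary, but the best weight is
      \<open>0\<close>.\<close>
    proof (cases "m = 0")
      case True
      then show ?thesis using best_orientation(2)[of ?S ?D] by simp
    next
      case False
      then have "1 / exp 1 \<le> secretary_value k m"
        unfolding k_def using someI_ex[OF ex_secretary_value_ge[of m]] by simp
      then show ?thesis using bw by (rule mult_right_mono)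
    qed
    have "1 / exp 1 * OPT m ends w \<le> 1 / exp 1 * best_weight ?D ?S"
      using OPT_le_best_weight[OF G \<pi>, of w] by (intro mult_left_mono) auto
    also note sv
    also have "secretary_value k m * best_weight ?D ?S \<le> perm_mean ?S ?W"
      using perm_mean_weight_marks[of ?S ?D k] w' by simp
    finally have "x * (1 / exp 1 * OPT m ends w) \<le> x * perm_mean ?S ?W"
      using x(1) by (rule mult_left_mono)
    \<comment> \<open>Marks are defined on lists with the latest arrival first; reversal preserves
      uniformity.\<close>
    also have "\<dots> = perm_mean ?S (\<lambda>\<sigma>. x * ?W (rev \<sigma>))"
      unfolding perm_mean_cmult by (simp only: perm_mean_rev[of ?S ?W])
    also have "\<dots> \<le> perm_mean ?S (\<lambda>\<sigma>. H \<sigma> (map \<pi> \<sigma>))"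
      using H by (rule perm_mean_mono)
    finally show ?thesis by simp
  qed
  then have "(\<Sum>\<pi> | \<pi> permutes ?S. ?L) \<le> (\<Sum>\<pi> | \<pi> permutes ?S. perm_mean ?S (\<lambda>\<sigma>. H \<sigma> (map \<pi> \<sigma>)))"
    by (intro sum_mono) auto
  moreover have "card {\<pi>. \<pi> permutes ?S} = fact m" by (rule card_permutations) auto
  ultimately have "?L \<le> perm_mean ?S (\<lambda>\<sigma>. perm_mean ?S (H \<sigma>))"
    by (simp add: perm_mean_relabel pos_le_divide_eq mult.commute)
  then show ?thesis unfolding expected_ALG_algorithm k_def[symmetric] H_def .
qed

theorem theorem2:
  "(\<forall>g::nat. g \<ge> 2 \<longrightarrow> (\<forall>\<epsilon>::real. \<epsilon> > 0 \<longrightarrow>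
      (\<exists>A :: 'v algorithm. \<forall>V m ends (w :: nat \<Rightarrow> real).
          multigraph V m ends \<and> (\<forall>e<m. w e \<ge> 0) \<and> girth_ge m ends g \<longrightarrow>
          expected_ALG A V m ends w \<ge> (xg g / exp 1 - \<epsilon>) * OPT m ends w)))
   \<and> (xg \<longlonglongrightarrow> 1)"
proof (intro conjI allI impI exI, elim conjE)
  fix g :: nat and \<epsilon> :: real and V m and ends :: "nat \<Rightarrow> 'v \<times> 'v" and w :: "nat \<Rightarrow> real"
  assume g: "g \<ge> 2" and \<epsilon>: "\<epsilon> > 0"
    and G: "multigraph V m ends" "\<forall>e<m. w e \<ge> 0" "girth_ge m ends g"
  obtain F where "F \<subseteq> {0..<m}" "OPT m ends w = sum w F" by (rule OPT_attained)
  then have "0 \<le> OPT m ends w" using G(2) by (auto intro!: sum_nonneg)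
  then have "(xg g / exp 1 - \<epsilon>) * OPT m ends w \<le> xg g / exp 1 * OPT m ends w"
    using \<epsilon> by (intro mult_right_mono) auto
  also have "\<dots> \<le> expected_ALG (algorithm (xg g)) V m ends w"
    using G by (intro algorithm_competitive[OF _ _ _ xg_root[OF g]]) auto
  finally show "(xg g / exp 1 - \<epsilon>) * OPT m ends w \<le> expected_ALG (algorithm (xg g)) V m ends w" .
qed (rule xg_tendsto_1)

end
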